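(* Let $p\ge1$, let $\rho$ be a nondegenerate (positive) $p\times p$ matrix measure on the unit circle, and let $\varphi_n^L(z)$ and $\varphi_n^R(z)$ be left and right orthonormal matrix polynomials with respect to $\rho$, with reflection coefficients $H_n$. Then $$\lim_{n\to\infty}H_n=0$$ if and only if $$\lim_{n\to\infty}\ \inf_{\ell\ge1}\ \frac1{2\pi}\int_0^{2\pi}\left\|\varphi_n^L(z)\,\varphi_{n+\ell}^L(z)^{-1}\,[\varphi_{n+\ell}^L(z)^*]^{-1}\,\varphi_n^L(z)^*-I\right\|_2\,d\theta=0,\qquad z=e^{i\theta}.$$
   Context: A (positive) $p\times p$ matrix measure $\rho$ on the unit circle $\mathbb{T}=\{z\in\mathbb{C}:|z|=1\}$ (identified with $[0,2\pi)$ via $z=e^{i\theta}$) is a finite countably additive Borel measure whose values are Hermitian positive semidefinite $p\times p$ complex matrices. It is nondegenerate if $\int_0^{2\pi} v(z)\,d\rho(\theta)\,v(z)^*>0$ for every nonzero row-vector polynomial $v$. $A^*$ denotes the Hermitian transpose of a matrix $A$, and $\|\cdot\|_2$ is the spectral norm (largest singular value). A matrix polynomial is a polynomial in $z$ with $p\times p$ complex matrix coefficients. The left and right orthonormal matrix polynomials $\varphi_n^L,\varphi_n^R$ ($n=0,1,2,\dots$) are matrix polynomials of degree $n$ with nonsingular leading coefficients such that, with $z=e^{i\theta}$, $$\int_0^{2\pi}\varphi_n^L(z)\,d\rho(\theta)\,[\varphi_m^L(z)]^*=\delta_{m,n}I=\int_0^{2\pi}[\varphi_n^R(z)]^*\,d\rho(\theta)\,\varphi_m^R(z).$$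 They are unique up to multiplication by a constant unitary matrix, on the left for $\varphi_n^L$ and on the right for $\varphi_n^R$. The matrices $\varphi_n^L(z)$ are invertible for every $z\in\mathbb{T}$. Write $\varphi_n^L(z)=L_{n,n}z^n+\cdots+L_{n,0}$ and $\varphi_n^R(z)=K_{n,n}z^n+\cdots+K_{n,0}$. The reflection coefficients are the $p\times p$ matrices $$H_n=(L_{n,n}^* )^{-1}K_{n,0}=L_{n,0}(K_{n,n}^* )^{-1},\qquad n\ge 1$$ (the two expressions agree). Changing the unitary normalization of $\varphi_n^L,\varphi_n^R$ replaces $H_n$ by $UH_nV$ with $U,V$ unitary and conjugates the matrix inside the norm by a unitary matrix, so the statement does not depend on the normalization. *)

theory Defs
  imports "HOL-Analysis.Analysis" "HOL-Computational_Algebra.Polynomial"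
begin

definition ctransp :: "complex^'n^'m \<Rightarrow> complex^'m^'n" where
  "ctransp A = (\<chi> i j. cnj (A $ j $ i))"

text \<open>The Hermitian form \<open>x A x\<^sup>*\<close> of a row vector \<open>x\<close>.\<close>
definition herm_form :: "complex^'n^'n \<Rightarrow> complex^'n \<Rightarrow> complex" where
  "herm_form A x = (\<Sum>i\<in>UNIV. \<Sum>j\<in>UNIV. x $ i * A $ i $ j * cnj (x $ j))"

definition pos_semidef :: "complex^'n^'n \<Rightarrow> bool" where
  "pos_semidef A \<longleftrightarrow> ctransp A = A \<and> (\<forall>x. 0 \<le> Re (herm_form A x))"

definition singular_value :: "complex^'n^'n \<Rightarrow> real \<Rightarrow> bool" where
  "singular_value A s \<longleftrightarrow>
     0 \<le> s \<and> (\<exists>v. v \<noteq> 0 \<and> (ctransp A ** A) *v v = complex_of_real (s\<^sup>2) *s v)"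

definition spectral_norm :: "complex^'n^'n \<Rightarrow> real" where
  "spectral_norm A = (GREATEST s. singular_value A s)"

abbreviation circle :: "complex measure" where
  "circle \<equiv> restrict_space borel (sphere 0 1)"

text \<open>Only the values on Borel subsets of the unit circle matter; finiteness of the measure is
  built into the codomain.\<close>
definition matrix_measure :: "(complex set \<Rightarrow> complex^'n^'n) \<Rightarrow> bool" where
  "matrix_measure \<rho> \<longleftrightarrow>
     (\<forall>E\<in>sets circle. pos_semidef (\<rho> E)) \<and>
     (\<forall>A::nat \<Rightarrow> complex set. range A \<subseteq> sets circle \<longrightarrow> disjoint_family A \<longrightarrow>
        (\<lambda>k. \<rho> (A k)) sums \<rho> (\<Union>k. A k))"

text \<open>Each \<open>x \<rho> x\<^sup>*\<close> is a finite positive measure. By polarization, the entry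
  \<open>\<rho>\<^sub>i\<^sub>j\<close>, a complex measure, is the combination
  \<open>1/4 \<Sum>k<4. \<i>^k x\<^sub>k \<rho> x\<^sub>k\<^sup>*\<close> with \<open>x\<^sub>k = e\<^sub>i + \<i>^k e\<^sub>j\<close> of four such measures
  (cf. \<open>entry_integral_indicator\<close> below), and integrals against it are defined by linearity.\<close>
definition form_measure :: "(complex set \<Rightarrow> complex^'n^'n) \<Rightarrow> complex^'n \<Rightarrow> complex measure" where
  "form_measure \<rho> x =
     measure_of (space circle) (sets circle) (\<lambda>E. ennreal (Re (herm_form (\<rho> E) x)))"

definition entry_integral ::
    "(complex set \<Rightarrow> complex^'n^'n) \<Rightarrow> 'n \<Rightarrow> 'n \<Rightarrow> (complex \<Rightarrow> complex) \<Rightarrow> complex" where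
  "entry_integral \<rho> i j f =
     (1/4) * (\<Sum>k<4. \<i> ^ k * (LINT z|form_measure \<rho> (axis i 1 + \<i> ^ k *s axis j 1). f z))"

text \<open>The integral \<open>\<integral> F(z) d\<rho> G(z)\<close>, with the matrix products in this order.\<close>
definition matrix_integral ::
    "(complex set \<Rightarrow> complex^'n^'n) \<Rightarrow> (complex \<Rightarrow> complex^'n^'a) \<Rightarrow> (complex \<Rightarrow> complex^'b^'n) \<Rightarrow>
      complex^'b^'a" where
  "matrix_integral \<rho> F G =
     (\<chi> i j. \<Sum>k\<in>UNIV. \<Sum>l\<in>UNIV. entry_integral \<rho> k l (\<lambda>z. F z $ i $ k * G z $ l $ j))"

text \<open>Matrix polynomials are polynomials with matrix coefficients. The library's \<open>poly\<close> is not
  used for evaluation, since multiplication on type \<open>vec\<close> is componentwise.\<close>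
definition mpoly_eval :: "(complex^'n^'m) poly \<Rightarrow> complex \<Rightarrow> complex^'n^'m" where
  "mpoly_eval P z = (\<Sum>k\<le>degree P. mat (z ^ k) ** coeff P k)"

text \<open>Row vectors are \<open>1 \<times> n\<close> matrices. For a matrix measure \<open>\<rho>\<close> the integral below
  is automatically real.\<close>
definition nondegenerate :: "(complex set \<Rightarrow> complex^'n^'n) \<Rightarrow> bool" where
  "nondegenerate \<rho> \<longleftrightarrow>
     (\<forall>v::(complex^'n^1) poly. v \<noteq> 0 \<longrightarrow>
        0 < Re (matrix_integral \<rho> (mpoly_eval v) (\<lambda>z. ctransp (mpoly_eval v z)) $ 1 $ 1))"

definition left_orthonormal ::
    "(complex set \<Rightarrow> complex^'n^'n) \<Rightarrow> (nat \<Rightarrow> (complex^'n^'n) poly) \<Rightarrow> bool" where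
  "left_orthonormal \<rho> \<phi> \<longleftrightarrow>
     (\<forall>n. degree (\<phi> n) = n \<and> invertible (lead_coeff (\<phi> n))) \<and>
     (\<forall>n m. matrix_integral \<rho> (mpoly_eval (\<phi> n)) (\<lambda>z. ctransp (mpoly_eval (\<phi> m) z)) =
        (if m = n then mat 1 else 0))"

definition right_orthonormal ::
    "(complex set \<Rightarrow> complex^'n^'n) \<Rightarrow> (nat \<Rightarrow> (complex^'n^'n) poly) \<Rightarrow> bool" where
  "right_orthonormal \<rho> \<phi> \<longleftrightarrow>
     (\<forall>n. degree (\<phi> n) = n \<and> invertible (lead_coeff (\<phi> n))) \<and>
     (\<forall>n m. matrix_integral \<rho> (\<lambda>z. ctransp (mpoly_eval (\<phi> n) z)) (mpoly_eval (\<phi> m)) =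
        (if m = n then mat 1 else 0))"

definition reflection_coeff ::
    "(nat \<Rightarrow> (complex^'n^'n) poly) \<Rightarrow> (nat \<Rightarrow> (complex^'n^'n) poly) \<Rightarrow> nat \<Rightarrow> complex^'n^'n" where
  "reflection_coeff \<phi>L \<phi>R n = matrix_inv (ctransp (coeff (\<phi>L n) n)) ** coeff (\<phi>R n) 0"

lemma herm_form_polarization:
  "A $ i $ j = (1/4) * (\<Sum>k<4. \<i> ^ k * herm_form A (axis i 1 + \<i> ^ k *s axis j 1))"
proof -
  have *: "herm_form A (axis i 1 + c *s axis j 1) =
      A $ i $ i + cnj c * A $ i $ j + c * A $ j $ i + c * cnj c * A $ j $ j" for c
  proof -
    have "herm_form A (axis i 1 + c *s axis j 1) =
      (\<Sum>k\<in>UNIV. \<Sum>l\<in>UNIV. ((if k = i then 1 else 0) + (if k = j then c else 0)) * A $ k $ l *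
         ((if l = i then 1 else 0) + (if l = j then cnj c else 0)))"
      unfolding herm_form_def axis_def by (intro sum.cong refl) auto
    also have "\<dots> = (\<Sum>k\<in>UNIV. ((if k = i then 1 else 0) + (if k = j then c else 0)) *
        (A $ k $ i + cnj c * A $ k $ j))"
      by (intro sum.cong refl)
        (simp add: distrib_left sum.distrib mult.assoc flip: sum_distrib_left,
         simp add: if_distrib cong: if_cong)
    also have "\<dots> = A $ i $ i + cnj c * A $ i $ j + c * A $ j $ i + c * cnj c * A $ j $ j"
      by (simp add: distrib_right sum.distrib) (simp add: if_distrib if_distribR algebra_simps cong: if_cong)
    finally show ?thesis .
  qed
  show ?thesis
    unfolding * by (simp add: eval_nat_numeral algebra_simps)
qed

lemma herm_form_real:
  assumes "ctransp A = A"
  shows "herm_form A x \<in> \<real>"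
proof -
  have "cnj (A $ i $ j) = A $ j $ i" for i j
    using arg_cong[OF assms, of "\<lambda>B. B $ j $ i"] by (simp add: ctransp_def)
  then have "cnj (herm_form A x) = (\<Sum>i\<in>UNIV. \<Sum>j\<in>UNIV. x $ j * A $ j $ i * cnj (x $ i))"
    by (simp add: herm_form_def mult_ac)
  also have "\<dots> = herm_form A x"
    unfolding herm_form_def by (rule sum.swap)
  finally show ?thesis by (simp add: Reals_cnj_iff)
qed

lemma herm_form_sums:
  assumes "f sums A"
  shows "(\<lambda>k. herm_form (f k) x) sums herm_form A x"
proof -
  have "(\<lambda>k. f k $ i $ j) sums A $ i $ j" for i j
    using bounded_linear.sums[OF bounded_linear_compose[OF bounded_linear_vec_nth bounded_linear_vec_nth] assms] .
  then show ?thesis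
    unfolding herm_form_def by (intro sums_sum sums_mult sums_mult2)
qed

lemma emeasure_form_measure:
  assumes "matrix_measure \<rho>" "E \<in> sets circle"
  shows "emeasure (form_measure \<rho> x) E = ennreal (Re (herm_form (\<rho> E) x))"
proof (rule emeasure_measure_of[OF form_measure_def])
  show "sets circle \<subseteq> Pow (space circle)"
    by (rule sets.space_closed)
  show "E \<in> sets (form_measure \<rho> x)"
    using assms(2) unfolding form_measure_def sets.sets_measure_of_eq by simp
  have add: "(\<lambda>k. \<rho> (A k)) sums \<rho> (\<Union>k. A k)"
    if "range A \<subseteq> sets circle" "disjoint_family A" for A :: "nat \<Rightarrow> complex set"
    using assms(1) that by (simp add: matrix_measure_def)
  have nn: "0 \<le> Re (herm_form (\<rho> A) x)" if "A \<in> sets circle" for A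
    using assms(1) that by (simp add: matrix_measure_def pos_semidef_def)
  have "(\<lambda>k::nat. \<rho> {}) sums \<rho> {}"
    using add[of "\<lambda>_. {}"] by (simp add: disjoint_family_on_def)
  then have "(\<lambda>k::nat. \<rho> {}) \<longlonglongrightarrow> 0"
    by (intro summable_LIMSEQ_zero) (rule sums_summable)
  then have "\<rho> {} = 0"
    by (simp add: LIMSEQ_const_iff)
  then show "positive (sets (form_measure \<rho> x)) (\<lambda>E. ennreal (Re (herm_form (\<rho> E) x)))"
    by (simp add: positive_def herm_form_def)
  show "countably_additive (sets (form_measure \<rho> x)) (\<lambda>E. ennreal (Re (herm_form (\<rho> E) x)))"
  proof (rule countably_additiveI)
    fix A :: "nat \<Rightarrow> complex set"
    assume "range A \<subseteq> sets (form_measure \<rho> x)" and dis: "disjoint_family A"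
    then have A: "range A \<subseteq> sets circle"
      unfolding form_measure_def sets.sets_measure_of_eq by simp
    have "(\<lambda>k. Re (herm_form (\<rho> (A k)) x)) sums Re (herm_form (\<rho> (\<Union>k. A k)) x)"
      by (intro sums_Re herm_form_sums add A dis)
    then show "(\<Sum>k. ennreal (Re (herm_form (\<rho> (A k)) x))) = ennreal (Re (herm_form (\<rho> (\<Union>k. A k)) x))"
      using A nn by (intro sums_unique[symmetric] sums_ennreal[THEN iffD2]) auto
  qed
qed

lemma entry_integral_indicator:
  assumes "matrix_measure \<rho>" "E \<in> sets circle"
  shows "entry_integral \<rho> i j (indicator E) = \<rho> E $ i $ j"
proof -
  have *: "(LINT z|form_measure \<rho> x. indicator E z) = herm_form (\<rho> E) x" for x
  proof -
    have psd: "pos_semidef (\<rho> E)"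
      using assms by (simp add: matrix_measure_def)
    have E: "E \<in> sets (form_measure \<rho> x)"
      using assms(2) unfolding form_measure_def sets.sets_measure_of_eq by simp
    have em: "emeasure (form_measure \<rho> x) E = ennreal (Re (herm_form (\<rho> E) x))"
      by (rule emeasure_form_measure[OF assms])
    have "(LINT z|form_measure \<rho> x. indicator E z :: complex) =
        of_real (LINT z|form_measure \<rho> x. indicator E z)"
      unfolding integral_complex_of_real[symmetric]
      by (intro Bochner_Integration.integral_cong refl) (simp split: split_indicator)
    also have "(LINT z|form_measure \<rho> x. indicator E z) = measure (form_measure \<rho> x) E"
      using E em by (simp add: sets.Int_space_eq2)
    also have "\<dots> = Re (herm_form (\<rho> E) x)"
      using em psd by (simp add: measure_def pos_semidef_def)
    also have "of_real \<dots> = herm_form (\<rho> E) x"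
      using herm_form_real[of "\<rho> E" x] psd by (simp add: pos_semidef_def of_real_Re)
    finally show ?thesis .
  qed
  show ?thesis
    unfolding entry_integral_def * by (rule herm_form_polarization[symmetric])
qed

lemma inner_ctransp:
  fixes A :: "complex^'n^'n"
  shows "inner ((ctransp A ** A) *v x) y = inner (A *v x) (A *v y)"
proof -
  have adj: "inner (ctransp A *v u) y = inner u (A *v y)" for u
  proof -
    have inner: "inner x z = Re (\<Sum>i\<in>UNIV. x $ i * cnj (z $ i))" for x z :: "complex^'n"
      by (simp add: inner_vec_def inner_complex_def)
    have "inner (ctransp A *v u) y = Re (\<Sum>i\<in>UNIV. \<Sum>j\<in>UNIV. cnj (A $ j $ i) * u $ j * cnj (y $ i))"
      unfolding inner by (simp only: matrix_vector_mult_def ctransp_def vec_lambda_beta sum_distrib_right)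
    also have "\<dots> = Re (\<Sum>j\<in>UNIV. \<Sum>i\<in>UNIV. cnj (A $ j $ i) * u $ j * cnj (y $ i))"
      by (subst sum.swap) (rule refl)
    also have "\<dots> = inner u (A *v y)"
      unfolding inner
      by (simp only: matrix_vector_mult_def vec_lambda_beta cnj_sum complex_cnj_mult sum_distrib_left mult_ac)
    finally show ?thesis .
  qed
  show ?thesis by (simp add: adj flip: matrix_vector_mul_assoc)
qed

lemma of_real_scale_vec: "complex_of_real c *s v = c *\<^sub>R v"
  by (simp add: vec_eq_iff scaleR_conv_of_real[where 'a = complex])

lemma spectral_norm_eq_onorm: "spectral_norm A = onorm (\<lambda>x. A *v x)"
  unfolding spectral_norm_def
proof (rule Greatest_equality)
  define f where "f = (\<lambda>x. A *v x)"
  have bl: "bounded_linear f"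
    unfolding f_def by (rule matrix_vector_mul_bounded_linear)
  define N where "N = onorm f"
  have N0: "0 \<le> N"
    unfolding N_def by (rule onorm_pos_le[OF bl])
  have le: "norm (f x) \<le> N * norm x" for x
    unfolding N_def by (rule onorm[OF bl])
  have cont: "continuous_on (sphere 0 1) (\<lambda>x. norm (f x))"
    by (intro continuous_intros bounded_linear.continuous_on[OF bl])
  have "axis undefined 1 \<in> (sphere 0 1 :: (complex^'a) set)"
    by (simp add: norm_axis_1)
  then obtain v where v: "v \<in> sphere 0 1" and max: "\<And>x. x \<in> sphere 0 1 \<Longrightarrow> norm (f x) \<le> norm (f v)"
    using continuous_attains_sup[OF compact_sphere _ cont] by blast
  have vN: "norm (f v) = N"
  proof (rule antisym)
    show "norm (f v) \<le> N" using le[of v] v by simp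
    have "norm (f x) \<le> norm (f v) * norm x" for x
    proof (cases "x = 0")
      case True
      then show ?thesis using bl by (simp add: linear_0 bounded_linear.linear)
    next
      case False
      have "norm (f (x /\<^sub>R norm x)) \<le> norm (f v)"
        using False by (intro max) simp
      then show ?thesis
        using False by (simp add: linear_cmul[OF bounded_linear.linear[OF bl]] field_simps)
    qed
    then show "N \<le> norm (f v)"
      unfolding N_def by (intro onorm_bound) auto
  qed
  have expand: "(norm (x + t *\<^sub>R y))\<^sup>2 = (norm x)\<^sup>2 + 2 * t * inner x y + t\<^sup>2 * (norm y)\<^sup>2"
    for x y :: "complex^'a" and t
    unfolding power2_norm_eq_inner inner_add_left inner_add_right inner_scaleR_left inner_scaleR_right
      inner_commute[of y x]
    by (simp add: power2_eq_square algebra_simps)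
  define g where "g = (\<lambda>x. (ctransp A ** A) *v x)"
  have g: "inner (g x) y = inner (f x) (f y)" for x y
    by (simp add: g_def f_def inner_ctransp)
  define w where "w = N\<^sup>2 *\<^sub>R v - g v"
  have ip: "0 \<le> 2 * t * inner w w + t\<^sup>2 * (N\<^sup>2 * (norm w)\<^sup>2 - (norm (f w))\<^sup>2)" for t
  proof -
    have "(norm (f (v + t *\<^sub>R w)))\<^sup>2 \<le> (N * norm (v + t *\<^sub>R w))\<^sup>2"
      by (intro power_mono le) simp
    also have "(norm (f (v + t *\<^sub>R w)))\<^sup>2 = N\<^sup>2 + 2 * t * inner (g v) w + t\<^sup>2 * (norm (f w))\<^sup>2"
      by (simp add: linear_add[OF bounded_linear.linear[OF bl]]
          linear_cmul[OF bounded_linear.linear[OF bl]] expand g vN)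
    also have "(N * norm (v + t *\<^sub>R w))\<^sup>2 = N\<^sup>2 * (1 + 2 * t * inner v w + t\<^sup>2 * (norm w)\<^sup>2)"
      using v by (simp add: power_mult_distrib expand)
    finally have "0 \<le> 2 * t * (N\<^sup>2 * inner v w - inner (g v) w) + t\<^sup>2 * (N\<^sup>2 * (norm w)\<^sup>2 - (norm (f w))\<^sup>2)"
      by (simp add: algebra_simps)
    also have "N\<^sup>2 * inner v w - inner (g v) w = inner w w"
      by (simp add: w_def inner_diff_left inner_diff_right algebra_simps)
    finally show ?thesis .
  qed
  have "w = 0"
  proof (rule ccontr)
    assume "w \<noteq> 0"
    define a where "a = inner w w"
    have a: "a > 0" using \<open>w \<noteq> 0\<close> by (simp add: a_def)
    define c where "c = N\<^sup>2 * (norm w)\<^sup>2 - (norm (f w))\<^sup>2"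
    have "(norm (f w))\<^sup>2 \<le> (N * norm w)\<^sup>2" by (intro power_mono le) simp
    then have c: "c \<ge> 0" by (simp add: c_def power_mult_distrib)
    define t where "t = - a / (c + 1)"
    have "0 \<le> 2 * t * a + t\<^sup>2 * c" using ip[of t] by (simp add: a_def c_def)
    also have "\<dots> = t * (2 * a + t * c)" by (simp add: algebra_simps power2_eq_square)
    finally have 1: "0 \<le> t * (2 * a + t * c)" .
    have 2: "t < 0" using a c by (simp add: t_def)
    have "a * c \<le> a * (c + 1)" using a by simp
    then have "- a \<le> t * c" using c by (simp add: t_def field_simps)
    then have "0 < 2 * a + t * c" using a by simp
    with 1 2 show False by (simp add: zero_le_mult_iff)
  qed
  then show "singular_value A (onorm (\<lambda>x. A *v x))"
    unfolding singular_value_def using v N0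
    by (intro conjI exI[of _ v]) (auto simp: w_def g_def N_def f_def of_real_scale_vec simp del: of_real_power)
  show "s \<le> onorm (\<lambda>x. A *v x)" if s: "singular_value A s" for s
  proof -
    from s obtain u where s0: "0 \<le> s" and u: "u \<noteq> 0" "g u = s\<^sup>2 *\<^sub>R u"
      by (auto simp: singular_value_def g_def of_real_scale_vec simp del: of_real_power)
    have "(s * norm u)\<^sup>2 = inner (g u) u"
      by (simp add: u power_mult_distrib power2_norm_eq_inner)
    also have "\<dots> = (norm (f u))\<^sup>2"
      by (simp add: g power2_norm_eq_inner)
    finally have "s * norm u = norm (f u)"
      using s0 by (simp add: power2_eq_iff_nonneg)
    then have "s * norm u \<le> N * norm u" using le[of u] by simp
    then have "s \<le> N" using u(1) by (simp add: mult_le_cancel_right)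
    then show ?thesis by (simp add: N_def f_def)
  qed
qed

end

theory Submission
  imports Defs "HOL-Complex_Analysis.Cauchy_Integral_Theorem"
begin

text \<open>Let \<open>p\<^sub>n\<close> be the left orthonormal polynomials and \<open>q\<^sub>n(z) = z\<^sup>n \<phi>\<^sup>R\<^sub>n(1/\<zeta>)\<^sup>*\<close> with
  \<open>\<zeta>\<close> the conjugate of \<open>z\<close>. They obey a Szego recurrence
  \<open>p\<^sub>n\<^sub>+\<^sub>1 = C (z p\<^sub>n + G q\<^sub>n)\<close>, \<open>q\<^sub>n\<^sub>+\<^sub>1 = E (q\<^sub>n + z G\<^sup>* p\<^sub>n)\<close> with
  \<open>G = - \<integral> z p\<^sub>n d\<rho> q\<^sub>n\<^sup>*\<close> and \<open>C (1 - G G\<^sup>*) C\<^sup>* = 1 = E (1 - G\<^sup>* G) E\<^sup>*\<close>.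
  Taking traces in \<open>H H\<^sup>* = C G G\<^sup>* C\<^sup>-\<^sup>1\<close> for \<open>H = H\<^sub>n\<^sub>+\<^sub>1\<close> shows that \<open>H\<^sub>n\<^sub>+\<^sub>1\<close> and \<open>G\<close> have the
  same Frobenius norm, so the claim is about \<open>G \<rightarrow> 0\<close>. On the circle \<open>q\<^sub>n p\<^sub>n\<^sup>-\<^sup>1\<close> is unitary, so
  the recurrence bounds the integrand for \<open>\<ell> = 1\<close> uniformly in terms of \<open>\<parallel>G\<parallel>\<close>.
  Conversely, the weight \<open>w = p\<^sub>m\<^sup>-\<^sup>1 p\<^sub>m\<^sup>-\<^sup>*\<close> has the same inner products as \<open>\<rho>\<close> up to level
  \<open>m = n + \<ell>\<close>, so \<open>- G\<close> is the mean of \<open>z (p\<^sub>n w p\<^sub>n\<^sup>*) V\<close> with \<open>V = (q\<^sub>n p\<^sub>n\<^sup>-\<^sup>1)\<^sup>*\<close> unitary. Since \<open>V\<close>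
  extends analytically to the disc, \<open>z V\<close> has mean \<open>0\<close>, and the entries of \<open>G\<close> are bounded by the
  mean of \<open>\<parallel>p\<^sub>n w p\<^sub>n\<^sup>* - 1\<parallel>\<close>.\<close>

subsection \<open>Complex matrices\<close>

text \<open>On a matrix, \<open>*s\<close> would take a row vector as scalar and
  \<open>*\<^sub>R\<close> takes reals only, hence a separate complex scaling.\<close>

definition scale_mat :: "complex \<Rightarrow> complex^'n^'m \<Rightarrow> complex^'n^'m" (infixr "*m" 75) where
  "c *m A = (\<chi> i j. c * A $ i $ j)"

lemma mat_mult_eq_scale_mat: "mat c ** A = c *m A"
  by (simp add: vec_eq_iff scale_mat_def matrix_matrix_mult_def mat_def if_distrib if_distribR cong: if_cong)

lemma scale_mat_nth [simp]: "(c *m A) $ i $ j = c * A $ i $ j"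
  by (simp add: scale_mat_def)

lemma ctransp_nth [simp]: "ctransp A $ i $ j = cnj (A $ j $ i)"
  by (simp add: ctransp_def)

lemma matrix_mul_nth: "(A ** B) $ i $ j = (\<Sum>k\<in>UNIV. A $ i $ k * B $ k $ j)"
  by (simp add: matrix_matrix_mult_def)

lemma mult_scale_mat [simp]: "A ** (c *m B) = c *m (A ** B)"
  by (simp add: vec_eq_iff matrix_mul_nth sum_distrib_left mult_ac)

lemma scale_mat_mult [simp]: "(c *m A) ** B = c *m (A ** B)"
  by (simp add: vec_eq_iff matrix_mul_nth sum_distrib_left mult_ac)

lemma scale_mat_scale_mat [simp]: "c *m d *m A = (c * d) *m A"
  by (simp add: vec_eq_iff)

lemma scale_mat_one [simp]: "1 *m A = A"
  by (simp add: vec_eq_iff)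

lemma scale_mat_zero [simp]: "c *m 0 = 0" "0 *m A = 0"
  by (simp_all add: vec_eq_iff)

lemma scale_mat_minus [simp]: "c *m (- A) = - (c *m A)"
  by (simp add: vec_eq_iff)

lemma scale_mat_distrib:
  "c *m (A + B) = c *m A + c *m B" "c *m (A - B) = c *m A - c *m B"
  by (simp_all add: vec_eq_iff algebra_simps)

lemma scale_mat_sum: "c *m (\<Sum>k\<in>S. f k) = (\<Sum>k\<in>S. c *m f k)"
  by (simp add: vec_eq_iff sum_distrib_left)

lemma ctransp_mult: "ctransp (A ** B) = ctransp B ** ctransp A"
  by (simp add: vec_eq_iff matrix_mul_nth mult.commute)

lemma ctransp_scale_mat [simp]: "ctransp (c *m A) = cnj c *m ctransp A"
  by (simp add: vec_eq_iff)

lemma ctransp_add [simp]: "ctransp (A + B) = ctransp A + ctransp B"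
  by (simp add: vec_eq_iff)

lemma ctransp_diff [simp]: "ctransp (A - B) = ctransp A - ctransp B"
  by (simp add: vec_eq_iff)

lemma ctransp_minus [simp]: "ctransp (- A) = - ctransp A"
  by (simp add: vec_eq_iff)

lemma ctransp_ctransp [simp]: "ctransp (ctransp A) = A"
  by (simp add: vec_eq_iff)

lemma ctransp_mat [simp]: "ctransp (mat c) = mat (cnj c)"
  by (auto simp: vec_eq_iff mat_def)

lemma ctransp_zero [simp]: "ctransp 0 = 0"
  by (simp add: vec_eq_iff)

lemma ctransp_sum: "ctransp (\<Sum>k\<in>S. f k) = (\<Sum>k\<in>S. ctransp (f k))"
  by (simp add: vec_eq_iff)

lemma transpose_nth [simp]: "transpose A $ i $ j = A $ j $ i"
  by (simp add: transpose_def)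

lemma transpose_scale_mat [simp]: "transpose (c *m A) = c *m transpose A"
  by (simp add: vec_eq_iff)

lemma transpose_minus [simp]: "transpose (- A) = - transpose (A :: complex^'n^'m)"
  by (simp add: vec_eq_iff)

lemma transpose_sum: "transpose (\<Sum>k\<in>S. f k) = (\<Sum>k\<in>S. transpose (f k))"
  by (simp add: vec_eq_iff)

lemma matrix_mul_distrib:
  fixes A B :: "complex^'n^'m"
  shows "A ** (C + D) = A ** C + A ** D" "(A + B) ** C = A ** C + B ** C"
    "A ** (C - D) = A ** C - A ** D" "(A - B) ** C = A ** C - B ** C"
    "A ** (- C) = - (A ** C)" "(- A) ** C = - (A ** C)"
  by (simp_all add: vec_eq_iff matrix_mul_nth sum.distrib sum_subtractf sum_negf algebra_simps)

lemma matrix_mul_zero [simp]: "A ** (0 :: complex^'k^'n) = 0" "(0 :: complex^'n^'m) ** B = 0"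
  by (simp_all add: vec_eq_iff matrix_mul_nth)

lemma matrix_mul_sum_left: "A ** (\<Sum>k\<in>S. f k) = (\<Sum>k\<in>S. A ** (f k :: complex^'k^'n))"
  by (induction S rule: infinite_finite_induct) (simp_all add: matrix_mul_distrib)

lemmas mat_simps = matrix_mul_distrib scale_mat_distrib matrix_mul_assoc[symmetric] ctransp_mult

lemma matrix_cancel: "A ** B = mat 1 \<Longrightarrow> A ** (B ** C) = C"
  by (simp add: matrix_mul_assoc)

lemma invertible_matrix_inv:
  fixes A :: "complex^'n^'n"
  assumes "invertible A"
  shows "A ** matrix_inv A = mat 1" "matrix_inv A ** A = mat 1"
  using someI_ex[OF assms[unfolded invertible_def]] by (auto simp: matrix_inv_def)

lemma matrix_inv_unique:
  fixes A :: "complex^'n^'n"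
  assumes "A ** B = mat 1"
  shows "matrix_inv A = B"
proof -
  have "invertible A"
    using assms matrix_left_right_inverse1 by (auto simp: invertible_def)
  then have "matrix_inv A ** (A ** B) = B"
    using invertible_matrix_inv(2) matrix_cancel by blast
  then show ?thesis using assms by simp
qed

lemma invertible_ctransp: "invertible A \<Longrightarrow> invertible (ctransp (A :: complex^'n^'n))"
  unfolding invertible_def by (metis ctransp_mult ctransp_mat complex_cnj_one)

lemma matrix_inv_ctransp:
  fixes A :: "complex^'n^'n"
  assumes "invertible A"
  shows "matrix_inv (ctransp A) = ctransp (matrix_inv A)"
proof (rule matrix_inv_unique)
  show "ctransp A ** ctransp (matrix_inv A) = mat 1"
    using arg_cong[OF invertible_matrix_inv(2)[OF assms], of ctransp] by (simp add: ctransp_mult)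
qed

lemma invertible_transpose: "invertible A \<Longrightarrow> invertible (transpose (A :: complex^'n^'n))"
  unfolding invertible_def by (metis matrix_transpose_mul transpose_mat)

lemma matrix_inv_mult:
  fixes A B :: "complex^'n^'n"
  assumes "invertible A" "invertible B"
  shows "matrix_inv (A ** B) = matrix_inv B ** matrix_inv A"
  by (rule matrix_inv_unique)
    (simp add: matrix_mul_assoc[symmetric] matrix_cancel[OF invertible_matrix_inv(1)] assms invertible_matrix_inv)

lemma invertible_iff_kernel:
  fixes A :: "complex^'n^'n"
  shows "invertible A \<longleftrightarrow> (\<forall>x. A *v x = 0 \<longrightarrow> x = 0)"
proof -
  have "(\<exists>B. B ** A = mat 1) \<longleftrightarrow> (\<forall>x. A *v x = 0 \<longrightarrow> x = 0)"
    by (rule matrix_left_invertible_ker)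
  then show ?thesis
    unfolding invertible_def using matrix_left_right_inverse1 by blast
qed

lemma scale_mat_vec: "(c *m A) *v x = c *s (A *v x)"
  by (simp add: vec_eq_iff matrix_vector_mult_def sum_distrib_left mult_ac)

lemma norm_scale_vec: "norm (c *s (x :: complex^'n)) = cmod c * norm x"
  by (simp add: norm_vec_def L2_set_def norm_mult power_mult_distrib real_sqrt_mult flip: sum_distrib_left)

lemma inner_mult_ctransp: "inner (A *v x) y = inner x (ctransp A *v (y :: complex^'n))"
proof -
  have inner: "inner x z = Re (\<Sum>i\<in>UNIV. x $ i * cnj (z $ i))" for x z :: "complex^'k"
    by (simp add: inner_vec_def inner_complex_def)
  have "inner (A *v x) y = Re (\<Sum>i\<in>UNIV. \<Sum>j\<in>UNIV. A $ i $ j * x $ j * cnj (y $ i))"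
    unfolding inner by (simp only: matrix_vector_mult_def vec_lambda_beta sum_distrib_right)
  also have "\<dots> = Re (\<Sum>j\<in>UNIV. \<Sum>i\<in>UNIV. A $ i $ j * x $ j * cnj (y $ i))"
    by (subst sum.swap) (rule refl)
  also have "\<dots> = inner x (ctransp A *v y)"
    unfolding inner
    by (simp only: matrix_vector_mult_def vec_lambda_beta ctransp_nth cnj_sum complex_cnj_mult
        complex_cnj_cnj sum_distrib_left mult_ac)
  finally show ?thesis .
qed

lemma norm_mult_vec_power2: "(norm (A *v x))\<^sup>2 = inner ((ctransp A ** A) *v x) (x :: complex^'n)"
  unfolding power2_norm_eq_inner
  by (simp only: inner_mult_ctransp[of A x "A *v x"] matrix_vector_mul_assoc inner_commute)

lemma norm_power2_vec: "(norm (x :: complex^'n))\<^sup>2 = (\<Sum>i\<in>UNIV. (cmod (x $ i))\<^sup>2)"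
  by (simp add: norm_vec_def L2_set_def sum_nonneg)

text \<open>The norm of nested vectors is the Frobenius norm; as a trace it can be handled by cyclic
  permutation.\<close>

lemma norm_mat_power2: "(norm (A :: complex^'n^'m))\<^sup>2 = Re (trace (A ** ctransp A))"
proof -
  have "(norm A)\<^sup>2 = (\<Sum>i\<in>UNIV. \<Sum>j\<in>UNIV. (cmod (A $ i $ j))\<^sup>2)"
    by (simp add: norm_vec_def L2_set_def sum_nonneg)
  also have "\<dots> = Re (trace (A ** ctransp A))"
    by (simp add: trace_def matrix_mul_nth complex_mult_cnj flip: cmod_power2)
  finally show ?thesis .
qed

lemma norm_ctransp: "norm (ctransp A) = norm (A :: complex^'n^'m)"
  by (rule power2_eq_imp_eq) (simp_all add: norm_mat_power2 trace_mul_sym[of "ctransp A"])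

text \<open>Cauchy-Schwarz in each row, then summation of the squares over the rows.\<close>

lemma norm_mat_vec_le: "norm (A *v x) \<le> norm A * norm (x :: complex^'n)"
proof (rule power2_le_imp_le)
  have row: "cmod ((A *v x) $ i) \<le> norm (A $ i) * norm x" for i
  proof -
    have "cmod ((A *v x) $ i) \<le> (\<Sum>j\<in>UNIV. \<bar>cmod (A $ i $ j)\<bar> * \<bar>cmod (x $ j)\<bar>)"
      unfolding matrix_vector_mult_def by (auto intro!: sum_norm_le simp: norm_mult)
    also have "\<dots> \<le> norm (A $ i) * norm x"
      unfolding norm_vec_def[of x] norm_vec_def[of "A $ i"] by (rule L2_set_mult_ineq)
    finally show ?thesis .
  qed
  have "(norm (A *v x))\<^sup>2 \<le> (\<Sum>i\<in>UNIV. (norm (A $ i) * norm x)\<^sup>2)"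
    unfolding norm_power2_vec by (intro sum_mono power_mono row) simp
  also have "\<dots> = (norm A * norm x)\<^sup>2"
    by (simp add: norm_vec_def[of A] L2_set_def sum_nonneg power_mult_distrib sum_distrib_right)
  finally show "(norm (A *v x))\<^sup>2 \<le> (norm A * norm x)\<^sup>2" .
qed simp

section \<open>Spectral norm\<close>

lemma spectral_norm_nonneg: "0 \<le> spectral_norm A"
  unfolding spectral_norm_eq_onorm by (rule onorm_pos_le) (rule matrix_vector_mul_bounded_linear)

lemma spectral_norm_vec_le: "norm (A *v x) \<le> spectral_norm A * norm x"
  unfolding spectral_norm_eq_onorm by (rule onorm) (rule matrix_vector_mul_bounded_linear)

lemma spectral_norm_le: "(\<And>x. norm (A *v x) \<le> b * norm x) \<Longrightarrow> spectral_norm A \<le> b"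
  unfolding spectral_norm_eq_onorm by (rule onorm_le)

lemma spectral_norm_le_norm: "spectral_norm A \<le> norm A"
  by (rule spectral_norm_le) (rule norm_mat_vec_le)

lemma spectral_norm_triangle: "spectral_norm (A + B) \<le> spectral_norm A + spectral_norm B"
  unfolding spectral_norm_eq_onorm matrix_vector_mult_add_rdistrib
  by (rule onorm_triangle) (rule matrix_vector_mul_bounded_linear)+

text \<open>The triangle inequality and domination by the Frobenius norm make
  \<open>spectral_norm\<close> 1-Lipschitz.\<close>

lemma continuous_on_spectral_norm:
  assumes "continuous_on S F"
  shows "continuous_on S (\<lambda>x. spectral_norm (F x))"
proof -
  have "spectral_norm A - spectral_norm B \<le> norm (A - B)" for A B :: "complex^'n^'n"
    using spectral_norm_triangle[of "A - B" B] spectral_norm_le_norm[of "A - B"] by simp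
  then have "\<bar>spectral_norm A - spectral_norm B\<bar> \<le> norm (A - B)" for A B :: "complex^'n^'n"
    by (smt (verit) norm_minus_commute)
  then have "1-lipschitz_on UNIV (spectral_norm :: complex^'n^'n \<Rightarrow> real)"
    by (auto intro!: lipschitz_onI simp: dist_norm)
  then have "continuous_on UNIV (spectral_norm :: complex^'n^'n \<Rightarrow> real)"
    by (rule lipschitz_on_continuous_on)
  then show ?thesis
    using continuous_on_compose2[OF _ assms] by blast
qed

section \<open>Continuity and holomorphy of matrix expressions\<close>

lemma continuous_on_mat_mult [continuous_intros]:
  fixes F :: "'a::topological_space \<Rightarrow> complex^'n^'m" and G :: "'a \<Rightarrow> complex^'k^'n"
  assumes "continuous_on S F" "continuous_on S G"
  shows "continuous_on S (\<lambda>x. F x ** G x)"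
  unfolding matrix_matrix_mult_def using assms
  by (intro continuous_intros)

lemma continuous_on_scale_mat [continuous_intros]:
  fixes F :: "'a::topological_space \<Rightarrow> complex^'n^'m"
  assumes "continuous_on S f" "continuous_on S F"
  shows "continuous_on S (\<lambda>x. f x *m F x)"
  unfolding scale_mat_def using assms by (intro continuous_intros)

lemma continuous_on_ctransp [continuous_intros]:
  fixes F :: "'a::topological_space \<Rightarrow> complex^'n^'m"
  assumes "continuous_on S F"
  shows "continuous_on S (\<lambda>x. ctransp (F x))"
  unfolding ctransp_def using assms by (intro continuous_intros)

lemma continuous_on_transpose [continuous_intros]:
  fixes F :: "'a::topological_space \<Rightarrow> complex^'n^'m"
  assumes "continuous_on S F"
  shows "continuous_on S (\<lambda>x. transpose (F x))"
  unfolding transpose_def using assms by (intro continuous_intros)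

text \<open>Cramer's rule for column \<open>j\<close> of the inverse, which solves
  \<open>A *v x = axis j 1\<close>. As quotients of determinants, the entries of an inverse inherit
  continuity and holomorphy.\<close>

lemma matrix_inv_nth:
  fixes A :: "complex^'n^'n"
  assumes "invertible A"
  shows "matrix_inv A $ i $ j = det (\<chi> a b. if b = i then (if a = j then 1 else 0) else A $ a $ b) / det A"
proof -
  have "A *v column j (matrix_inv A) = axis j 1"
    using arg_cong[OF invertible_matrix_inv(1)[OF assms], of "column j"]
    by (simp add: column_def vec_eq_iff matrix_vector_mult_def matrix_mul_nth mat_def axis_def)
  then have "column j (matrix_inv A) = (\<chi> k. det (\<chi> a b. if b = k then axis j 1 $ a else A $ a $ b) / det A)"
    using assms by (subst (asm) cramer) (auto simp: invertible_det_nz)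
  from arg_cong[OF this, of "\<lambda>v. v $ i"] show ?thesis
    by (simp add: column_def axis_def cong: if_cong)
qed

lemma continuous_on_det:
  fixes F :: "'a::topological_space \<Rightarrow> complex^'n^'n"
  assumes "\<And>i j. continuous_on S (\<lambda>x. F x $ i $ j)"
  shows "continuous_on S (\<lambda>x. det (F x))"
  unfolding det_def
  by (intro continuous_on_sum continuous_on_mult continuous_on_prod continuous_on_const assms)

lemma holomorphic_on_det:
  fixes F :: "complex \<Rightarrow> complex^'n^'n"
  assumes "\<And>i j. (\<lambda>x. F x $ i $ j) holomorphic_on S"
  shows "(\<lambda>x. det (F x)) holomorphic_on S"
  unfolding det_def using assms by (intro holomorphic_intros)

lemma continuous_on_matrix_inv:
  fixes F :: "'a::topological_space \<Rightarrow> complex^'n^'n"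
  assumes F: "continuous_on S F" and inv: "\<And>x. x \<in> S \<Longrightarrow> invertible (F x)"
  shows "continuous_on S (\<lambda>x. matrix_inv (F x))"
proof -
  have F': "continuous_on S (\<lambda>x. F x $ i $ j)" for i j
    using F by (intro continuous_intros)
  have "continuous_on S (\<lambda>x. if b = i then if a = j then 1 else 0 else F x $ a $ b)" for a b i j
    using F' by (cases "b = i"; cases "a = j") simp_all
  then have "continuous_on S (\<lambda>x. det (\<chi> a b. if b = i then if a = j then 1 else 0 else F x $ a $ b) / det (F x))"
    for i j
    using inv by (intro continuous_on_divide continuous_on_det F') (auto simp: invertible_det_nz)
  then have "continuous_on S (\<lambda>x. matrix_inv (F x) $ i $ j)" for i j
    by (subst continuous_on_cong[OF refl matrix_inv_nth[OF inv]])
  then have "continuous_on S (\<lambda>x. \<chi> i j. matrix_inv (F x) $ i $ j)"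
    by (intro continuous_on_vec_lambda)
  then show ?thesis by simp
qed

lemma holomorphic_on_matrix_inv:
  fixes F :: "complex \<Rightarrow> complex^'n^'n"
  assumes F: "\<And>i j. (\<lambda>x. F x $ i $ j) holomorphic_on S" and inv: "\<And>x. x \<in> S \<Longrightarrow> invertible (F x)"
  shows "(\<lambda>x. matrix_inv (F x) $ i $ j) holomorphic_on S"
proof (rule holomorphic_transform)
  have "(\<lambda>x. if b = i then if a = j then 1 else 0 else F x $ a $ b) holomorphic_on S" for a b
    using F by (cases "b = i"; cases "a = j") simp_all
  then show "(\<lambda>x. det (\<chi> a b. if b = i then if a = j then 1 else 0 else F x $ a $ b) / det (F x)) holomorphic_on S"
    using inv by (intro holomorphic_on_divide holomorphic_on_det F) (auto simp: invertible_det_nz)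
qed (simp add: matrix_inv_nth inv)

text \<open>Right polynomials are handled through their transposes; on these, the adjoint of the
  original polynomial is plain conjugation of the entries.\<close>

definition mat_cnj :: "complex^'n^'m \<Rightarrow> complex^'n^'m" where
  "mat_cnj A = (\<chi> i j. cnj (A $ i $ j))"

lemma mat_cnj_nth [simp]: "mat_cnj A $ i $ j = cnj (A $ i $ j)"
  by (simp add: mat_cnj_def)

lemma mat_cnj_simps [simp]:
  "mat_cnj (A ** B) = mat_cnj A ** mat_cnj B"
  "mat_cnj (A + A') = mat_cnj A + mat_cnj A'"
  "mat_cnj (A - A') = mat_cnj A - mat_cnj A'"
  "mat_cnj (c *m A) = cnj c *m mat_cnj A"
  "mat_cnj (mat_cnj A) = A"
  "mat_cnj (transpose A) = ctransp A"
  "transpose (ctransp A) = mat_cnj A"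
  "ctransp (mat_cnj A) = transpose A"
  "mat_cnj (ctransp A) = transpose A"
  "ctransp (transpose A) = mat_cnj A"
  "transpose (mat_cnj A) = ctransp A"
  "mat_cnj (mat d) = mat (cnj d)"
  by (auto simp: vec_eq_iff matrix_mul_nth mat_def)

lemma mat_cnj_sum: "mat_cnj (\<Sum>k\<in>S. f k) = (\<Sum>k\<in>S. mat_cnj (f k))"
  by (simp add: vec_eq_iff)

lemma invertible_mat_cnj: "invertible A \<Longrightarrow> invertible (mat_cnj (A :: complex^'n^'n))"
  by (metis invertible_ctransp invertible_transpose mat_cnj_simps(7))

subsection \<open>Matrix polynomials\<close>

definition ev :: "nat \<Rightarrow> (nat \<Rightarrow> complex^'n^'m) \<Rightarrow> complex \<Rightarrow> complex^'n^'m" where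
  "ev n c z = (\<Sum>k\<le>n. z ^ k *m c k)"

text \<open>Conjugating the value at \<open>1 / cnj z\<close> and multiplying by
  \<open>z ^ n\<close> reverses the order of the coefficients. Applied to the transpose of the right
  polynomial, this yields \<open>q\<^sub>n\<close> of the overview.\<close>

definition rev_coeff :: "nat \<Rightarrow> (nat \<Rightarrow> complex^'n^'m) \<Rightarrow> nat \<Rightarrow> complex^'n^'m" where
  "rev_coeff n c k = mat_cnj (c (n - k))"

lemma continuous_on_ev [continuous_intros]: "continuous_on S (ev n c)"
  unfolding ev_def by (intro continuous_intros)

lemma holomorphic_on_ev: "(\<lambda>z. ev n c z $ i $ j) holomorphic_on S"
  unfolding ev_def by (simp, intro holomorphic_intros)

lemma ev_0 [simp]: "ev n c 0 = c 0"
  by (simp add: ev_def power_0_left if_distrib[of "\<lambda>x. x *m _"] cong: if_cong)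

lemma ev_degree_0 [simp]: "ev 0 c z = c 0"
  by (simp add: ev_def)

lemma ev_rev_coeff:
  assumes "z \<noteq> 0"
  shows "ev n (rev_coeff n c) z = z ^ n *m mat_cnj (ev n c (1 / cnj z))"
proof -
  have "ev n (rev_coeff n c) z = (\<Sum>k\<le>n. z ^ (n - k) *m mat_cnj (c k))"
    unfolding ev_def rev_coeff_def
    by (rule sum.reindex_bij_witness[where i = "\<lambda>k. n - k" and j = "\<lambda>k. n - k"]) auto
  also have "\<dots> = z ^ n *m mat_cnj (ev n c (1 / cnj z))"
    unfolding ev_def mat_cnj_sum scale_mat_sum
    using assms by (intro sum.cong) (auto simp: power_diff power_divide)
  finally show ?thesis .
qed

lemma ev_rev_coeff_circle: "cmod z = 1 \<Longrightarrow> ev n (rev_coeff n c) z = z ^ n *m mat_cnj (ev n c z)"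
  by (subst ev_rev_coeff) (auto simp: divide_conv_cnj)

lemma ev_rev_coeff_rev_coeff: "ev n (rev_coeff n (rev_coeff n c)) = ev n c"
  unfolding ev_def rev_coeff_def by (intro ext sum.cong) auto

lemma ev_rev_coeff_inverse:
  assumes "z \<noteq> 0"
  shows "z ^ n *m mat_cnj (ev n (rev_coeff n c) (1 / cnj z)) = ev n c z"
  using ev_rev_coeff[OF assms, of n "rev_coeff n c"] by (simp add: ev_rev_coeff_rev_coeff)

lemma ev_split_first: "ev n c z = c 0 + z *m (\<Sum>k<n. z ^ k *m c (Suc k))"
  unfolding ev_def lessThan_Suc_atMost[symmetric] sum.lessThan_Suc_shift
  by (simp add: scale_mat_sum)

lemma ev_split_last: "ev n c z = (\<Sum>k<n. z ^ k *m c k) + z ^ n *m c n"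
  by (simp add: ev_def lessThan_Suc_atMost[symmetric])

lemma ev_Suc_split:
  "ev (Suc n) c z = c 0 + z *m (\<Sum>k<n. z ^ k *m c (Suc k)) + z ^ Suc n *m c (Suc n)"
  by (subst ev_split_first) (simp add: scale_mat_distrib add.assoc)

subsection \<open>Matrix inner products on the circle\<close>

text \<open>\<open>e k l f\<close> plays the role of \<open>\<integral> f d\<mu>\<^sub>k\<^sub>l\<close> for a matrix measure \<open>\<mu>\<close>.
  Right orthonormal polynomials enter through their transposes, which are left orthonormal for the
  transposed functional \<open>\<lambda>k l. e l k\<close>; every statement about left polynomials thus has a right
  counterpart by duality.\<close>

definition ip ::
    "('n::finite \<Rightarrow> 'n \<Rightarrow> (complex \<Rightarrow> complex) \<Rightarrow> complex) \<Rightarrow>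
      (complex \<Rightarrow> complex^'n^'n) \<Rightarrow> (complex \<Rightarrow> complex^'n^'n) \<Rightarrow> complex^'n^'n" where
  "ip e F G = (\<chi> i j. \<Sum>k\<in>UNIV. \<Sum>l\<in>UNIV. e k l (\<lambda>z. F z $ i $ k * cnj (G z $ j $ l)))"

text \<open>Row \<open>n\<close> of \<open>a\<close> lists the coefficients of the polynomial of
  index \<open>n\<close>. Since \<open>ev n\<close> stops at \<open>n\<close>, invertibility of
  \<open>a n n\<close> fixes its degree.\<close>

definition orthonormal_seq ::
    "('n::finite \<Rightarrow> 'n \<Rightarrow> (complex \<Rightarrow> complex) \<Rightarrow> complex) \<Rightarrow> (nat \<Rightarrow> nat \<Rightarrow> complex^'n^'n) \<Rightarrow> bool" where
  "orthonormal_seq e a \<longleftrightarrow>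
    (\<forall>n. invertible (a n n)) \<and>
    (\<forall>n m. ip e (ev n (a n)) (ev m (a m)) = (if m = n then mat 1 else 0))"

abbreviation cont :: "(complex \<Rightarrow> 'b::topological_space) \<Rightarrow> bool" where
  "cont \<equiv> continuous_on (sphere 0 1)"

text \<open>These laws are shared by a matrix measure, its transpose and the weights used later, so
  the theory of the recurrence is developed once for all of them. \<open>e_cnj\<close> expresses
  that the measure is Hermitian.\<close>

locale circle_functional =
  fixes e :: "'n::finite \<Rightarrow> 'n \<Rightarrow> (complex \<Rightarrow> complex) \<Rightarrow> complex"
  assumes e_add: "cont f \<Longrightarrow> cont g \<Longrightarrow> e k l (\<lambda>z. f z + g z) = e k l f + e k l g"
    and e_mult: "cont f \<Longrightarrow> e k l (\<lambda>z. c * f z) = c * e k l f"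
    and e_cong: "(\<And>z. cmod z = 1 \<Longrightarrow> f z = g z) \<Longrightarrow> e k l f = e k l g"
    and e_cnj: "cont f \<Longrightarrow> e k l (\<lambda>z. cnj (f z)) = cnj (e l k f)"
begin

lemma dual: "circle_functional (\<lambda>k l. e l k)"
  by unfold_locales (fact e_add e_mult e_cong e_cnj)+

lemma e_sum:
  assumes "finite S" "\<And>s. s \<in> S \<Longrightarrow> cont (f s)"
  shows "e k l (\<lambda>z. \<Sum>s\<in>S. f s z) = (\<Sum>s\<in>S. e k l (f s))"
  using assms
proof (induction S rule: finite_induct)
  case empty
  show ?case using e_mult[of "\<lambda>_. 0" k l 0] by simp
next
  case (insert s S)
  then show ?case
    by (simp add: e_add continuous_on_sum)
qed

lemma cont_nth: "cont F \<Longrightarrow> cont (\<lambda>z. F z $ i $ k)"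
  for F :: "complex \<Rightarrow> complex^'n^'n"
  by (intro continuous_intros)

lemma ip_cong:
  assumes "\<And>z. cmod z = 1 \<Longrightarrow> F z = F' z" "\<And>z. cmod z = 1 \<Longrightarrow> G z = G' z"
  shows "ip e F G = ip e F' G'"
  unfolding ip_def vec_eq_iff using assms by (auto intro!: sum.cong e_cong)

lemma ip_add_left:
  assumes "cont F" "cont F'" "cont G"
  shows "ip e (\<lambda>z. F z + F' z) G = ip e F G + ip e F' G"
  unfolding ip_def vec_eq_iff
  using assms by (auto simp: distrib_right sum.distrib e_add continuous_on_mult continuous_on_cnj cont_nth)

lemma ip_sum_left:
  assumes "finite S" "\<And>s. s \<in> S \<Longrightarrow> cont (F s)" "cont G"
  shows "ip e (\<lambda>z. \<Sum>s\<in>S. F s z) G = (\<Sum>s\<in>S. ip e (F s) G)"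
  using assms(1,2)
proof (induction S rule: finite_induct)
  case empty
  have "e k l (\<lambda>z. 0) = 0" for k l
    using e_mult[of "\<lambda>_. 0" k l 0] by simp
  then show ?case by (simp add: ip_def vec_eq_iff)
next
  case (insert s S)
  then show ?case
    by (simp add: ip_add_left continuous_on_sum assms(3))
qed

lemma ip_mult_left:
  assumes "cont F" "cont G"
  shows "ip e (\<lambda>z. K ** F z) G = K ** ip e F G"
proof -
  have "e k l (\<lambda>z. (K ** F z) $ i $ k * cnj (G z $ j $ l)) =
      (\<Sum>s\<in>UNIV. K $ i $ s * e k l (\<lambda>z. F z $ s $ k * cnj (G z $ j $ l)))" for i j k l
    using assms
    by (simp add: matrix_mul_nth sum_distrib_right mult.assoc e_sum e_mult
        continuous_on_mult continuous_on_cnj cont_nth)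
  then have "ip e (\<lambda>z. K ** F z) G $ i $ j =
      (\<Sum>k\<in>UNIV. \<Sum>l\<in>UNIV. \<Sum>s\<in>UNIV. K $ i $ s * e k l (\<lambda>z. F z $ s $ k * cnj (G z $ j $ l)))" for i j
    by (simp add: ip_def)
  also have "\<dots> i j = (\<Sum>s\<in>UNIV. \<Sum>k\<in>UNIV. \<Sum>l\<in>UNIV. K $ i $ s * e k l (\<lambda>z. F z $ s $ k * cnj (G z $ j $ l)))"
    for i j
    by (subst (2) sum.swap, subst sum.swap) (rule refl)
  also have "\<dots> i j = (K ** ip e F G) $ i $ j" for i j
    by (simp add: ip_def matrix_mul_nth sum_distrib_left)
  finally show ?thesis by (simp add: vec_eq_iff)
qed

lemma ip_ctransp:
  assumes "cont F" "cont G"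
  shows "ctransp (ip e F G) = ip e G F"
proof -
  have "cnj (e k l (\<lambda>z. F z $ i $ k * cnj (G z $ j $ l))) =
      e l k (\<lambda>z. G z $ j $ l * cnj (F z $ i $ k))" for i j k l
    using e_cnj[of "\<lambda>z. F z $ i $ k * cnj (G z $ j $ l)" l k] assms
    by (simp add: continuous_on_mult continuous_on_cnj cont_nth mult.commute)
  then show ?thesis
    unfolding vec_eq_iff ip_def by (simp, subst sum.swap, simp)
qed

lemma ip_add_right:
  assumes "cont F" "cont G" "cont G'"
  shows "ip e F (\<lambda>z. G z + G' z) = ip e F G + ip e F G'"
  by (subst (1 2 3) ip_ctransp[symmetric]) (simp_all add: assms continuous_on_add ip_add_left)

lemma ip_mult_right:
  assumes "cont F" "cont G"
  shows "ip e F (\<lambda>z. K ** G z) = ip e F G ** ctransp K"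
  by (subst (1 2) ip_ctransp[symmetric])
    (simp_all add: assms continuous_on_mat_mult ip_mult_left ctransp_mult)

lemma ip_sum_right:
  assumes "finite S" "\<And>s. s \<in> S \<Longrightarrow> cont (G s)" "cont F"
  shows "ip e F (\<lambda>z. \<Sum>s\<in>S. G s z) = (\<Sum>s\<in>S. ip e F (G s))"
proof -
  have "ip e F (\<lambda>z. \<Sum>s\<in>S. G s z) = ctransp (ip e (\<lambda>z. \<Sum>s\<in>S. G s z) F)"
    using assms by (intro ip_ctransp[symmetric] continuous_on_sum) auto
  also have "\<dots> = (\<Sum>s\<in>S. ctransp (ip e (G s) F))"
    using assms by (simp add: ip_sum_left ctransp_sum)
  also have "\<dots> = (\<Sum>s\<in>S. ip e F (G s))"
    using assms by (intro sum.cong ip_ctransp) auto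
  finally show ?thesis .
qed

text \<open>The unimodular factor meets its own conjugate and cancels; in particular multiplication
  by \<open>z\<close> is an isometry.\<close>

lemma ip_shift:
  assumes "\<And>z. cmod z = 1 \<Longrightarrow> cmod (u z) = 1"
  shows "ip e (\<lambda>z. u z *m F z) (\<lambda>z. u z *m G z) = ip e F G"
proof -
  have "e k l (\<lambda>z. (u z *m F z) $ i $ k * cnj ((u z *m G z) $ j $ l)) =
      e k l (\<lambda>z. F z $ i $ k * cnj (G z $ j $ l))" for i j k l
  proof (rule e_cong)
    fix z
    assume "cmod z = 1"
    then have "u z * cnj (u z) = 1"
      using assms by (simp add: complex_norm_square[symmetric])
    then show "(u z *m F z) $ i $ k * cnj ((u z *m G z) $ j $ l) = F z $ i $ k * cnj (G z $ j $ l)"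
      unfolding scale_mat_nth complex_cnj_mult
      by (metis (no_types, opaque_lifting) mult.assoc mult.left_commute mult_1)
  qed
  then show ?thesis by (simp only: ip_def)
qed

text \<open>The entries commute, so exchanging the indices of the functional amounts to conjugating
  and swapping the arguments. This carries facts about \<open>b\<close> over to the reversed
  polynomials for \<open>e\<close>.\<close>

lemma ip_dual: "ip (\<lambda>k l. e l k) F G = transpose (ip e (\<lambda>z. mat_cnj (G z)) (\<lambda>z. mat_cnj (F z)))"
proof -
  have "ip (\<lambda>k l. e l k) F G $ i $ j = ip e (\<lambda>z. mat_cnj (G z)) (\<lambda>z. mat_cnj (F z)) $ j $ i" for i j
  proof -
    have "ip (\<lambda>k l. e l k) F G $ i $ j =
        (\<Sum>l\<in>UNIV. \<Sum>k\<in>UNIV. e l k (\<lambda>z. F z $ i $ k * cnj (G z $ j $ l)))"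
      unfolding ip_def vec_lambda_beta by (rule sum.swap)
    then show ?thesis by (simp add: ip_def mult.commute)
  qed
  then show ?thesis by (simp add: vec_eq_iff)
qed

lemma ip_ev_right:
  assumes "cont F"
  shows "ip e F (ev n c) = (\<Sum>k\<le>n. ip e F (\<lambda>z. z ^ k *m mat 1) ** ctransp (c k))"
proof -
  have "ip e F (ev n c) = ip e F (\<lambda>z. \<Sum>k\<le>n. c k ** (z ^ k *m mat 1))"
    by (rule ip_cong) (simp_all add: ev_def)
  also have "\<dots> = (\<Sum>k\<le>n. ip e F (\<lambda>z. z ^ k *m mat 1) ** ctransp (c k))"
  proof (subst ip_sum_right)
    have "cont (\<lambda>z. z ^ k *m (mat 1 :: complex^'n^'n))" for k
      by (intro continuous_intros)
    then show "(\<Sum>k\<le>n. ip e F (\<lambda>z. c k ** (z ^ k *m mat 1))) =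
        (\<Sum>k\<le>n. ip e F (\<lambda>z. z ^ k *m mat 1) ** ctransp (c k))"
      using assms by (intro sum.cong refl ip_mult_right)
  qed (auto intro!: continuous_intros assms)
  finally show ?thesis .
qed

end

section \<open>Szego recurrence\<close>

lemma matrix_mul_right_cancel_zero:
  fixes A B :: "complex^'n^'n"
  assumes "A ** B = 0" "invertible B"
  shows "A = 0"
proof -
  have "A ** (B ** matrix_inv B) = 0"
    by (simp only: matrix_mul_assoc assms(1) matrix_mul_zero)
  then show ?thesis using assms(2) by (simp add: invertible_matrix_inv)
qed

text \<open>Comparing coefficients of \<open>z ^ Suc n\<close> in the recurrence forces this value
  of the factor \<open>C\<close>.\<close>

definition leading_ratio :: "(nat \<Rightarrow> nat \<Rightarrow> complex^'n^'n) \<Rightarrow> nat \<Rightarrow> complex^'n^'n" where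
  "leading_ratio a n = a (Suc n) (Suc n) ** matrix_inv (a n n)"

text \<open>The factor \<open>E\<close> of the recurrence for the reversed polynomials; reversal
  brings in the conjugate.\<close>

definition dual_ratio :: "(nat \<Rightarrow> nat \<Rightarrow> complex^'n^'n) \<Rightarrow> nat \<Rightarrow> complex^'n^'n" where
  "dual_ratio b n = mat_cnj (leading_ratio b n)"

context circle_functional
begin

abbreviation mono :: "nat \<Rightarrow> complex \<Rightarrow> complex^'n^'n" where
  "mono j \<equiv> \<lambda>z. z ^ j *m mat 1"

lemma cont_mono: "cont (mono j)"
  by (intro continuous_intros)

lemma ip_dual': "ip e F G = transpose (ip (\<lambda>k l. e l k) (\<lambda>z. mat_cnj (G z)) (\<lambda>z. mat_cnj (F z)))"
  using circle_functional.ip_dual[OF dual] .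

text \<open>Expanding \<open>ev j (a j)\<close> in monomials, the lower ones vanish by induction,
  and the invertible coefficient \<open>a j j\<close> can be cancelled from the one that is
  left.\<close>

lemma orthonormal_seq_monomial:
  assumes "orthonormal_seq e a" "j < n"
  shows "ip e (ev n (a n)) (mono j) = 0"
  using assms(2)
proof (induction j rule: less_induct)
  case (less j)
  have "0 = ip e (ev n (a n)) (ev j (a j))"
    using assms(1) less.prems by (simp add: orthonormal_seq_def)
  also have "\<dots> = (\<Sum>k\<le>j. ip e (ev n (a n)) (mono k) ** ctransp (a j k))"
    by (rule ip_ev_right) (intro continuous_intros)
  also have "\<dots> = ip e (ev n (a n)) (mono j) ** ctransp (a j j)"
    using less by (simp add: lessThan_Suc_atMost[symmetric])
  finally show ?case
    using assms(1) matrix_mul_right_cancel_zero invertible_ctransp by (metis orthonormal_seq_def)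
qed

lemma orthogonal_to_ev:
  assumes "cont F" "\<And>j. j \<le> n \<Longrightarrow> ip e F (mono j) = 0"
  shows "ip e F (ev n c) = 0"
  using assms by (simp add: ip_ev_right)

text \<open>Pairing with \<open>ev N (a N)\<close> sees only the top coefficient, through an
  invertible matrix, so the coefficients vanish from the top down. Definiteness on polynomials is
  thus drawn from the orthonormal sequence.\<close>

lemma eq_zero_if_orthogonal:
  assumes a: "orthonormal_seq e a"
    and "\<And>j. j < N \<Longrightarrow> ip e (\<lambda>z. \<Sum>k<N. z ^ k *m c k) (mono j) = 0" "k < N"
  shows "c k = 0"
  using assms(2,3)
proof (induction N arbitrary: k)
  case (Suc N)
  define B where "B = ip e (mono N) (ev N (a N))"
  have expand: "ip e (ev N d) (ev N (a N)) = d N ** B" for d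
  proof -
    have "ip e (ev N (a N)) (ev N d) = (\<Sum>k\<le>N. ip e (ev N (a N)) (mono k) ** ctransp (d k))"
      by (rule ip_ev_right) (intro continuous_intros)
    also have "\<dots> = ip e (ev N (a N)) (mono N) ** ctransp (d N)"
      using orthonormal_seq_monomial[OF a] by (simp add: lessThan_Suc_atMost[symmetric])
    finally have "ctransp (ip e (ev N (a N)) (ev N d)) = d N ** ctransp (ip e (ev N (a N)) (mono N))"
      by (simp add: ctransp_mult)
    then show ?thesis
      by (simp add: ip_ctransp cont_mono continuous_on_ev B_def)
  qed
  \<comment> \<open>For \<open>d = a N\<close> the left side of \<open>expand\<close> is the
    identity by normalization.\<close>
  have "a N N ** B = mat 1"
    using expand[of "a N"] a by (simp add: orthonormal_seq_def)
  then have "invertible B"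
    using matrix_left_right_inverse1 by (auto simp: invertible_def)
  moreover have "ip e (ev N c) (ev N (a N)) = 0"
  proof (rule orthogonal_to_ev)
    have "ev N c = (\<lambda>z. \<Sum>k<Suc N. z ^ k *m c k)"
      by (simp add: ev_def fun_eq_iff lessThan_Suc_atMost[symmetric])
    then show "ip e (ev N c) (mono j) = 0" if "j \<le> N" for j
      using Suc.prems(1)[of j] that by (simp only: less_Suc_eq_le)
  qed (rule continuous_on_ev)
  ultimately have cN: "c N = 0"
    unfolding expand by (metis matrix_mul_right_cancel_zero)
  with Suc show ?case
    by (cases "k = N") (auto simp: less_Suc_eq)
qed simp

text \<open>On the circle \<open>z ^ j\<close> is \<open>z ^ n\<close> times the conjugate of
  \<open>z ^ (n - j)\<close>. Once the common factor \<open>z ^ n\<close> is dropped, duality leaves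
  the orthogonality of \<open>ev n (b n)\<close> to degree \<open>n - j\<close>, which is below
  \<open>n\<close> because \<open>1 \<le> j\<close>.\<close>

lemma rev_coeff_monomial:
  assumes b: "orthonormal_seq (\<lambda>k l. e l k) b" and j: "1 \<le> j" "j \<le> n"
  shows "ip e (ev n (rev_coeff n (b n))) (mono j) = 0"
proof -
  have "ip e (ev n (rev_coeff n (b n))) (mono j) =
      ip e (\<lambda>z. z ^ n *m mat_cnj (ev n (b n) z)) (\<lambda>z. z ^ n *m mat_cnj (z ^ (n - j) *m mat 1))"
  proof (rule ip_cong)
    fix z :: complex
    assume z: "cmod z = 1"
    then show "ev n (rev_coeff n (b n)) z = z ^ n *m mat_cnj (ev n (b n) z)"
      by (rule ev_rev_coeff_circle)
    have "z ^ n = z ^ j * z ^ (n - j)"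
      using j by (simp add: power_add[symmetric])
    moreover have "z ^ (n - j) * cnj z ^ (n - j) = 1"
      using z by (simp add: power_mult_distrib[symmetric] complex_norm_square[symmetric])
    ultimately show "mono j z = z ^ n *m mat_cnj (z ^ (n - j) *m mat 1)"
      by (simp add: mult.assoc)
  qed
  also have "\<dots> = ip e (\<lambda>z. mat_cnj (ev n (b n) z)) (\<lambda>z. mat_cnj (z ^ (n - j) *m mat 1))"
    by (rule ip_shift) (simp add: norm_power)
  also have "\<dots> = transpose (ip (\<lambda>k l. e l k) (mono (n - j)) (ev n (b n)))"
    by (subst ip_dual') simp
  also have "ip (\<lambda>k l. e l k) (mono (n - j)) (ev n (b n)) =
      ctransp (ip (\<lambda>k l. e l k) (ev n (b n)) (mono (n - j)))"
    using circle_functional.ip_ctransp[OF dual continuous_on_ev cont_mono] by simp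
  also have "ip (\<lambda>k l. e l k) (ev n (b n)) (mono (n - j)) = 0"
    using j by (intro circle_functional.orthonormal_seq_monomial[OF dual b]) simp
  finally show ?thesis by (simp add: vec_eq_iff)
qed

lemma rev_coeff_normalized:
  assumes b: "orthonormal_seq (\<lambda>k l. e l k) b"
  shows "ip e (ev n (rev_coeff n (b n))) (ev n (rev_coeff n (b n))) = mat 1"
proof -
  have "ip e (ev n (rev_coeff n (b n))) (ev n (rev_coeff n (b n))) =
      ip e (\<lambda>z. z ^ n *m mat_cnj (ev n (b n) z)) (\<lambda>z. z ^ n *m mat_cnj (ev n (b n) z))"
    by (rule ip_cong) (simp_all add: ev_rev_coeff_circle)
  also have "\<dots> = ip e (\<lambda>z. mat_cnj (ev n (b n) z)) (\<lambda>z. mat_cnj (ev n (b n) z))"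
    by (rule ip_shift) (simp add: norm_power)
  also have "\<dots> = transpose (ip (\<lambda>k l. e l k) (ev n (b n)) (ev n (b n)))"
    by (subst ip_dual') simp
  finally show ?thesis
    using b by (simp add: orthonormal_seq_def transpose_mat)
qed

definition schur_param :: "(nat \<Rightarrow> nat \<Rightarrow> complex^'n^'n) \<Rightarrow> (nat \<Rightarrow> nat \<Rightarrow> complex^'n^'n) \<Rightarrow> nat \<Rightarrow> complex^'n^'n" where
  "schur_param a b n = - ip e (\<lambda>z. z *m ev n (a n) z) (ev n (rev_coeff n (b n)))"

text \<open>Factoring out \<open>z ^ Suc n\<close> and conjugating exchanges the shifted polynomial
  of one family with the reversed polynomial of the other. A single parameter therefore serves both
  recurrences.\<close>

lemma schur_param_dual:
  "circle_functional.schur_param (\<lambda>k l. e l k) b a n = transpose (schur_param a b n)"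
proof -
  have "ip e (\<lambda>z. z *m ev n (a n) z) (ev n (rev_coeff n (b n))) =
      ip e (\<lambda>z. z ^ Suc n *m mat_cnj (ev n (rev_coeff n (a n)) z))
        (\<lambda>z. z ^ Suc n *m mat_cnj (z *m ev n (b n) z))"
  proof (rule ip_cong)
    fix z :: complex
    assume z: "cmod z = 1"
    then have zz: "z * cnj z = 1" by (simp add: complex_norm_square[symmetric])
    have "z ^ n * cnj z ^ n = 1"
      using zz by (simp add: power_mult_distrib[symmetric])
    then show "z *m ev n (a n) z = z ^ Suc n *m mat_cnj (ev n (rev_coeff n (a n)) z)"
      using z by (simp add: ev_rev_coeff_circle mult.assoc)
    have "z ^ Suc n * cnj z = z ^ n"
      using zz by (simp add: mult_ac)
    then show "ev n (rev_coeff n (b n)) z = z ^ Suc n *m mat_cnj (z *m ev n (b n) z)"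
      unfolding ev_rev_coeff_circle[OF z] by (simp del: power_Suc)
  qed
  also have "\<dots> = ip e (\<lambda>z. mat_cnj (ev n (rev_coeff n (a n)) z)) (\<lambda>z. mat_cnj (z *m ev n (b n) z))"
    by (rule ip_shift) (simp only: norm_power power_one)
  also have "\<dots> = transpose (ip (\<lambda>k l. e l k) (\<lambda>z. z *m ev n (b n) z) (ev n (rev_coeff n (a n))))"
    by (subst ip_dual') simp
  finally show ?thesis
    unfolding schur_param_def circle_functional.schur_param_def[OF dual] by simp
qed

text \<open>Matching the top and the constant coefficient leaves a remainder \<open>z *m F z\<close>
  with \<open>F\<close> of degree below \<open>n\<close>. All terms are orthogonal to
  \<open>z ^ 1\<close>, ..., \<open>z ^ n\<close>, so \<open>F\<close> is orthogonal to all lower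
  monomials and vanishes. The second identity is the normalization of the new polynomial.\<close>

lemma szego_recurrence:
  assumes a: "orthonormal_seq e a" and b: "orthonormal_seq (\<lambda>k l. e l k) b"
  defines "C \<equiv> leading_ratio a" and "G \<equiv> schur_param a b"
  shows "ev (Suc n) (a (Suc n)) z = C n ** (z *m ev n (a n) z + G n ** ev n (rev_coeff n (b n)) z)"
    and "C n ** (mat 1 - G n ** ctransp (G n)) ** ctransp (C n) = mat 1"
proof -
  define p q where "p = ev n (a n)" and "q = ev n (rev_coeff n (b n))"
  \<comment> \<open>\<open>D\<close> matches the constant terms, as \<open>C n\<close> matches the
    leading ones. Below, \<open>f\<close> is read only at successors, so \<open>k - 1\<close> does
    not truncate.\<close>
  define D where "D = a (Suc n) 0 ** matrix_inv (rev_coeff n (b n) 0)"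
  define f where "f k = a (Suc n) k - C n ** a n (k - 1) - D ** rev_coeff n (b n) k" for k
  define F where "F = (\<lambda>z. \<Sum>k<n. z ^ k *m f (Suc k))"
  have cp [simp]: "cont p" "cont q" "cont (\<lambda>z. z *m p z)" "cont (ev n c)" for n and c :: "nat \<Rightarrow> complex^'n^'n"
    unfolding p_def q_def by (intro continuous_intros)+
  have cF: "cont F" unfolding F_def by (intro continuous_intros)
  have Ca: "C n ** a n n = a (Suc n) (Suc n)"
    using a by (simp add: C_def leading_ratio_def orthonormal_seq_def invertible_matrix_inv matrix_mul_assoc[symmetric])
  have Dq: "D ** rev_coeff n (b n) 0 = a (Suc n) 0"
    using b by (simp add: D_def orthonormal_seq_def invertible_mat_cnj rev_coeff_def invertible_matrix_inv matrix_mul_assoc[symmetric])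
  have zp: "z *m p z = z *m (\<Sum>k<n. z ^ k *m a n k) + z ^ Suc n *m a n n" for z
    by (simp add: p_def ev_split_last scale_mat_distrib)
  have dec: "ev (Suc n) (a (Suc n)) z = C n ** (z *m p z) + D ** q z + z *m F z" for z
    unfolding ev_Suc_split[of n "a (Suc n)"] zp F_def f_def q_def
    by (subst ev_split_first)
      (simp add: matrix_mul_distrib Ca Dq scale_mat_distrib sum.distrib sum_subtractf matrix_mul_sum_left scale_mat_sum)
  have p_orth: "ip e p (mono j) = 0" if "j < n" for j
    unfolding p_def using a that by (rule orthonormal_seq_monomial)
  have zp_orth: "ip e (\<lambda>z. z *m p z) (mono (Suc j)) = ip e p (mono j)" for j
  proof -
    have "ip e (\<lambda>z. z *m p z) (mono (Suc j)) = ip e (\<lambda>z. z *m p z) (\<lambda>z. z *m mono j z)"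
      by (rule ip_cong) simp_all
    also have "\<dots> = ip e p (mono j)"
      by (rule ip_shift) simp
    finally show ?thesis .
  qed
  have "ip e F (mono j) = 0" if "j < n" for j
  proof -
    have "ip e F (mono j) = ip e (\<lambda>z. z *m F z) (\<lambda>z. z *m mono j z)"
      by (rule ip_shift[symmetric]) simp
    also have "\<dots> = ip e (\<lambda>z. ev (Suc n) (a (Suc n)) z + (- C n) ** (z *m p z) + (- D) ** q z) (mono (Suc j))"
      by (rule ip_cong) (simp_all add: dec matrix_mul_distrib)
    also have "\<dots> = ip e (ev (Suc n) (a (Suc n))) (mono (Suc j)) + (- C n) ** ip e p (mono j)
        + (- D) ** ip e q (mono (Suc j))"
      by (simp only: ip_add_left ip_mult_left cp cont_mono continuous_on_add continuous_on_mat_mult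
          continuous_on_const zp_orth)
    also have "\<dots> = 0"
      using that rev_coeff_monomial[OF b, of "Suc j" n] orthonormal_seq_monomial[OF a, of "Suc j" "Suc n"]
      by (simp add: p_orth q_def)
    finally show ?thesis .
  qed
  then have "f (Suc k) = 0" if "k < n" for k
    using eq_zero_if_orthogonal[OF a, of n "\<lambda>k. f (Suc k)" k] that by (simp add: F_def)
  then have rec: "ev (Suc n) (a (Suc n)) z = C n ** (z *m p z) + D ** q z" for z
    by (simp add: dec F_def)
  have qq: "ip e q q = mat 1"
    unfolding q_def by (rule rev_coeff_normalized[OF b])
  \<comment> \<open>The new polynomial is orthogonal to degree \<open>n\<close>, hence to
    \<open>q\<close>; this pairing determines \<open>D\<close>.\<close>
  have "0 = ip e (ev (Suc n) (a (Suc n))) q"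
    unfolding q_def
    by (rule orthogonal_to_ev[symmetric]) (simp_all add: orthonormal_seq_monomial[OF a])
  also have "\<dots> = C n ** ip e (\<lambda>z. z *m p z) q + D ** ip e q q"
    unfolding rec[abs_def]
    by (simp only: ip_add_left ip_mult_left cp continuous_on_mat_mult continuous_on_const)
  finally have D: "D = C n ** G n"
    by (simp add: qq G_def schur_param_def p_def[symmetric] q_def[symmetric] matrix_mul_distrib eq_neg_iff_add_eq_0 add.commute)
  show r: "ev (Suc n) (a (Suc n)) z = C n ** (z *m ev n (a n) z + G n ** ev n (rev_coeff n (b n)) z)" for z
    unfolding rec D p_def q_def by (simp add: matrix_mul_distrib matrix_mul_assoc)
  have zpq: "ip e (\<lambda>z. z *m p z) q = - G n"
    by (simp add: G_def schur_param_def p_def q_def)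
  then have qzp: "ip e q (\<lambda>z. z *m p z) = - ctransp (G n)"
    by (subst ip_ctransp[symmetric]) simp_all
  have zpzp: "ip e (\<lambda>z. z *m p z) (\<lambda>z. z *m p z) = mat 1"
    using a by (subst ip_shift) (simp_all add: p_def orthonormal_seq_def)
  \<comment> \<open>The bracket of the recurrence: its Gram matrix is what \<open>C n\<close>
    normalizes.\<close>
  define s where "s = (\<lambda>z. z *m p z + G n ** q z)"
  have cs: "cont s" "cont (\<lambda>z. G n ** q z)" unfolding s_def by (intro continuous_intros cp)+
  have "ip e s s = ip e (\<lambda>z. z *m p z) s + G n ** ip e q s"
    using cs unfolding s_def by (simp only: ip_add_left ip_mult_left cp)
  also have "\<dots> = mat 1 - G n ** ctransp (G n)"
    using cs(2) unfolding s_def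
    by (simp only: ip_add_right ip_mult_right cp zpq qzp zpzp qq) (simp add: mat_simps)
  finally have ss: "ip e s s = mat 1 - G n ** ctransp (G n)" .
  have "mat 1 = ip e (ev (Suc n) (a (Suc n))) (ev (Suc n) (a (Suc n)))"
    using a by (simp add: orthonormal_seq_def)
  also have "\<dots> = ip e (\<lambda>z. C n ** s z) (\<lambda>z. C n ** s z)"
    by (rule ip_cong) (simp_all add: r s_def p_def q_def)
  also have "\<dots> = C n ** (mat 1 - G n ** ctransp (G n)) ** ctransp (C n)"
    using cs(1) by (simp add: ip_mult_left ip_mult_right continuous_on_mat_mult ss matrix_mul_assoc)
  finally show "C n ** (mat 1 - G n ** ctransp (G n)) ** ctransp (C n) = mat 1" by simp
qed

text \<open>The recurrence of the dual functional, with the two families exchanged, evaluated at the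
  reflected point \<open>1 / cnj z\<close> and conjugated.\<close>

lemma szego_recurrence_reversed:
  assumes a: "orthonormal_seq e a" and b: "orthonormal_seq (\<lambda>k l. e l k) b"
  defines "E \<equiv> dual_ratio b" and "G \<equiv> schur_param a b"
  shows "ev (Suc n) (rev_coeff (Suc n) (b (Suc n))) z =
      E n ** (ev n (rev_coeff n (b n)) z + z *m (ctransp (G n) ** ev n (a n) z))"
    and "E n ** (mat 1 - ctransp (G n) ** G n) ** ctransp (E n) = mat 1"
proof -
  have E: "leading_ratio b n = mat_cnj (E n)"
    by (simp add: E_def dual_ratio_def)
  have r: "ev (Suc n) (b (Suc n)) z =
      mat_cnj (E n) ** (z *m ev n (b n) z + transpose (G n) ** ev n (rev_coeff n (a n)) z)" for z
    using circle_functional.szego_recurrence(1)[OF dual b a, of n z]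
    by (simp add: schur_param_dual G_def E)
  show "ev (Suc n) (rev_coeff (Suc n) (b (Suc n))) z =
      E n ** (ev n (rev_coeff n (b n)) z + z *m (ctransp (G n) ** ev n (a n) z))"
  proof (cases "z = 0")
    \<comment> \<open>Reflection excludes the origin, where only the relation between the leading
      coefficients of \<open>b\<close> remains.\<close>
    case True
    have "b (Suc n) (Suc n) = mat_cnj (E n) ** b n n"
      using b unfolding E[symmetric] leading_ratio_def orthonormal_seq_def
      by (simp add: invertible_matrix_inv matrix_mul_assoc[symmetric])
    then show ?thesis
      using True by (simp add: rev_coeff_def)
  next
    case False
    define w where "w = 1 / cnj z"
    have w: "z * cnj w = 1" "cnj w \<noteq> 0" using False by (simp_all add: w_def)
    have "ev (Suc n) (rev_coeff (Suc n) (b (Suc n))) z = z ^ Suc n *m mat_cnj (ev (Suc n) (b (Suc n)) w)"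
      unfolding w_def by (rule ev_rev_coeff[OF False])
    also have "\<dots> = E n ** ((z * cnj w * z ^ n) *m mat_cnj (ev n (b n) w) +
        z *m (ctransp (G n) ** (z ^ n *m mat_cnj (ev n (rev_coeff n (a n)) w))))"
      unfolding r by (simp add: scale_mat_distrib matrix_mul_distrib mult_ac)
    also have "\<dots> = E n ** (ev n (rev_coeff n (b n)) z + z *m (ctransp (G n) ** ev n (a n) z))"
      using ev_rev_coeff[OF False, of n "b n"] ev_rev_coeff_inverse[OF False, of n "a n"] w
      by (simp add: w_def)
    finally show ?thesis .
  qed
  have "mat_cnj (E n) ** (mat 1 - transpose (G n) ** ctransp (transpose (G n))) ** ctransp (mat_cnj (E n)) = mat 1"
    using circle_functional.szego_recurrence(2)[OF dual b a, of n]
    by (simp add: schur_param_dual G_def E)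
  from arg_cong[OF this, of mat_cnj]
  show "E n ** (mat 1 - ctransp (G n) ** G n) ** ctransp (E n) = mat 1"
    by simp
qed

end

section \<open>Algebra of a single recurrence step\<close>

locale schur_step =
  fixes C E G :: "complex^'n^'n"
  assumes C: "C ** (mat 1 - G ** ctransp G) ** ctransp C = mat 1"
    and E: "E ** (mat 1 - ctransp G ** G) ** ctransp E = mat 1"
begin

lemma flip: "schur_step E C (ctransp G)"
  using C E by (simp add: schur_step_def)

text \<open>One-sided inverses of square matrices are two-sided, so the outer factors of
  \<open>C\<close> may be moved around: \<open>ctransp C ** C\<close> inverts
  \<open>mat 1 - G ** ctransp G\<close>.\<close>

lemma CC: "(mat 1 - G ** ctransp G) ** (ctransp C ** C) = mat 1"
    "(ctransp C ** C) ** (mat 1 - G ** ctransp G) = mat 1"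
proof -
  have "C ** ((mat 1 - G ** ctransp G) ** ctransp C) = mat 1"
    using C by (simp add: matrix_mul_assoc)
  from matrix_left_right_inverse1[OF this]
  show "(mat 1 - G ** ctransp G) ** (ctransp C ** C) = mat 1"
    by (simp add: matrix_mul_assoc)
  then show "(ctransp C ** C) ** (mat 1 - G ** ctransp G) = mat 1"
    by (rule matrix_left_right_inverse1)
qed

lemma invertible_C: "invertible C"
proof -
  have "C ** ((mat 1 - G ** ctransp G) ** ctransp C) = mat 1"
    using C by (simp add: matrix_mul_assoc)
  then show ?thesis
    using matrix_left_right_inverse1 by (auto simp: invertible_def)
qed

text \<open>\<open>G\<close> intertwines \<open>mat 1 - ctransp G ** G\<close> with
  \<open>mat 1 - G ** ctransp G\<close>, hence also their inverses.\<close>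

lemma CC_G: "ctransp C ** C ** G = G ** (ctransp E ** E)"
proof -
  interpret f: schur_step E C "ctransp G" by (rule flip)
  have EE: "(mat 1 - ctransp G ** G) ** (ctransp E ** E) = mat 1"
    using f.CC(1) by simp
  have "ctransp C ** C ** G = ctransp C ** C ** G ** ((mat 1 - ctransp G ** G) ** (ctransp E ** E))"
    by (simp add: EE)
  also have "\<dots> = ((ctransp C ** C) ** (mat 1 - G ** ctransp G)) ** G ** (ctransp E ** E)"
    by (simp add: mat_simps)
  also have "\<dots> = G ** (ctransp E ** E)"
    by (simp add: CC(2))
  finally show ?thesis .
qed

text \<open>The free tail \<open>X\<close> lets simp apply the relation inside right-nested
  products.\<close>

lemma CC_G_assoc: "ctransp C ** (C ** (G ** X)) = G ** (ctransp E ** (E ** X))"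
  using arg_cong[OF CC_G, of "\<lambda>Y. Y ** X"] by (simp add: matrix_mul_assoc)

lemma GG_CC_assoc: "G ** (ctransp G ** (ctransp C ** (C ** X))) = ctransp C ** (C ** X) - X"
proof -
  have "X = (mat 1 - G ** ctransp G) ** (ctransp C ** C) ** X"
    by (simp add: CC(1))
  also have "\<dots> = ctransp C ** (C ** X) - G ** (ctransp G ** (ctransp C ** (C ** X)))"
    by (simp add: mat_simps)
  finally show ?thesis by (simp add: algebra_simps)
qed

text \<open>The step is a block matrix acting on \<open>z *m p\<close> and \<open>q\<close>;
  \<open>CC_G\<close> and \<open>CC\<close> show that its inverse has the blocks
  \<open>ctransp C\<close>, \<open>- G ** ctransp E\<close>, \<open>- ctransp G ** ctransp C\<close>
  and \<open>ctransp E\<close>.\<close>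

lemma recurrence_inverse:
  assumes p': "p' = C ** (z *m p + G ** q)" and q': "q' = E ** (q + z *m (ctransp G ** p))"
  shows "z *m p = ctransp C ** p' - G ** (ctransp E ** q')"
    and "q = ctransp E ** q' - ctransp G ** (ctransp C ** p')"
proof -
  interpret f: schur_step E C "ctransp G" by (rule flip)
  show "z *m p = ctransp C ** p' - G ** (ctransp E ** q')"
    unfolding p' q'
    by (simp add: mat_simps CC_G_assoc f.CC_G_assoc[simplified] GG_CC_assoc)
  show "q = ctransp E ** q' - ctransp G ** (ctransp C ** p')"
    unfolding p' q'
    by (simp add: mat_simps CC_G_assoc f.CC_G_assoc[simplified] f.GG_CC_assoc[simplified])
qed

text \<open>The step preserves the indefinite form given by the difference of the two Gram matrices,
  evaluated at \<open>z *m p\<close> and \<open>q\<close>; only the factor \<open>z * cnj z\<close>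
  records the shift.\<close>

lemma gram_difference:
  assumes p': "p' = C ** (z *m p + G ** q)" and q': "q' = E ** (q + z *m (ctransp G ** p))"
  shows "ctransp q' ** q' - ctransp p' ** p' = ctransp q ** q - (z * cnj z) *m (ctransp p ** p)"
proof -
  interpret f: schur_step E C "ctransp G" by (rule flip)
  show ?thesis
    unfolding p' q'
    by (simp add: mat_simps CC_G_assoc f.CC_G_assoc[simplified] GG_CC_assoc f.GG_CC_assoc[simplified] mult_ac)
qed

text \<open>\<open>mat 1 - G ** ctransp G\<close> is the Gram matrix of an injective matrix, so the
  adjoint of \<open>G\<close> strictly shortens every nonzero vector.\<close>

lemma strict_contraction:
  assumes "norm v \<le> norm (ctransp G *v v)"
  shows "v = 0"
proof -
  define P where "P = mat 1 - G ** ctransp G"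
  have P: "ctransp P = P" "ctransp C ** (C ** P) = mat 1"
    using CC(2) by (simp_all add: P_def ctransp_mult matrix_mul_assoc)
  have "ctransp (C ** P) ** (C ** P) = P"
    by (simp add: ctransp_mult P matrix_mul_assoc[symmetric])
  then have "(norm ((C ** P) *v v))\<^sup>2 = inner (P *v v) v"
    by (simp only: norm_mult_vec_power2)
  also have "\<dots> = (norm v)\<^sup>2 - (norm (ctransp G *v v))\<^sup>2"
    using norm_mult_vec_power2[of "ctransp G" v]
    by (simp add: P_def matrix_vector_mult_diff_rdistrib inner_diff_left power2_norm_eq_inner)
  also have "\<dots> \<le> 0"
    using assms by (simp add: power_mono)
  finally have "(C ** P) *v v = 0" by simp
  then have "(ctransp C ** (C ** P)) *v v = 0"
    by (simp only: matrix_vector_mul_assoc[symmetric] matrix_vector_mult_0_right)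
  then show ?thesis by (simp add: P)
qed

text \<open>A kernel vector \<open>v\<close> of the bracket would give
  \<open>norm (q *v v) \<le> norm (ctransp G *v (p *v v))\<close>, so \<open>le\<close> and strict
  contraction force \<open>p *v v = 0\<close>, then \<open>q *v v = 0\<close>. The norm inequality
  survives by \<open>gram_difference\<close> and \<open>cmod z \<le> 1\<close>.\<close>

lemma invertible_step:
  fixes p q :: "complex^'n^'n"
  assumes p': "p' = C ** (z *m p + G ** q)" and q': "q' = E ** (q + z *m (ctransp G ** p))"
    and le: "\<And>v. norm (p *v v) \<le> norm (q *v v)" and "invertible q" "cmod z \<le> 1"
  shows "invertible q'" "norm (p' *v v) \<le> norm (q' *v v)"
proof -
  interpret f: schur_step E C "ctransp G" by (rule flip)
  have "invertible (q + z *m (ctransp G ** p))"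
    unfolding invertible_iff_kernel
  proof (intro allI impI)
    fix v assume "(q + z *m (ctransp G ** p)) *v v = 0"
    then have qv: "q *v v = - (z *s (ctransp G *v (p *v v)))"
      by (simp add: matrix_vector_mult_add_rdistrib scale_mat_vec matrix_vector_mul_assoc[symmetric] eq_neg_iff_add_eq_0)
    have "norm (p *v v) \<le> norm (q *v v)" by (rule le)
    also have "\<dots> \<le> norm (ctransp G *v (p *v v))"
      using \<open>cmod z \<le> 1\<close> by (simp add: qv norm_scale_vec mult_left_le_one_le)
    finally have "p *v v = 0" by (rule strict_contraction)
    then have "q *v v = 0" by (simp add: qv)
    then show "v = 0" using \<open>invertible q\<close> by (simp add: invertible_iff_kernel)
  qed
  then show "invertible q'"
    unfolding q' by (intro invertible_mult f.invertible_C)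
  have "(norm (q' *v v))\<^sup>2 - (norm (p' *v v))\<^sup>2 = (norm (q *v v))\<^sup>2 - (cmod z)\<^sup>2 * (norm (p *v v))\<^sup>2"
  proof -
    have "(norm (q' *v v))\<^sup>2 - (norm (p' *v v))\<^sup>2 = inner ((ctransp q' ** q' - ctransp p' ** p') *v v) v"
      by (simp only: norm_mult_vec_power2 matrix_vector_mult_diff_rdistrib inner_diff_left)
    also have "\<dots> = inner ((ctransp q ** q - ((complex_of_real ((cmod z)\<^sup>2)) *m (ctransp p ** p))) *v v) v"
      by (simp only: gram_difference[OF p' q'] complex_norm_square)
    also have "\<dots> = (norm (q *v v))\<^sup>2 - (cmod z)\<^sup>2 * (norm (p *v v))\<^sup>2"
      by (simp only: norm_mult_vec_power2 matrix_vector_mult_diff_rdistrib inner_diff_left scale_mat_vec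
          of_real_scale_vec inner_scaleR_left)
    finally show ?thesis .
  qed
  moreover have "(cmod z)\<^sup>2 * (norm (p *v v))\<^sup>2 \<le> 1 * (norm (q *v v))\<^sup>2"
    using \<open>cmod z \<le> 1\<close> le by (intro mult_mono power_mono) (auto simp: power_le_one)
  ultimately have "(norm (p' *v v))\<^sup>2 \<le> (norm (q' *v v))\<^sup>2" by linarith
  then show "norm (p' *v v) \<le> norm (q' *v v)"
    by (rule power2_le_imp_le) simp
qed

text \<open>\<open>K\<close> inverts \<open>ctransp C\<close>. Moving \<open>ctransp E ** E\<close>
  across \<open>G\<close> makes the product of \<open>K ** G ** ctransp E\<close> with its adjoint
  similar to \<open>G ** ctransp G\<close> through \<open>C\<close>, and the trace is a similarity
  invariant.\<close>

lemma norm_reflection: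
  assumes K: "ctransp C ** K = mat 1"
  shows "norm (K ** G ** ctransp E) = norm G"
proof (rule power2_eq_imp_eq)
  have "ctransp K ** C = mat 1"
    using arg_cong[OF K, of ctransp] matrix_left_right_inverse1 by (fastforce simp: ctransp_mult)
  then have KC: "C ** ctransp K = mat 1"
    by (rule matrix_left_right_inverse1)
  have "K ** G ** ctransp E ** ctransp (K ** G ** ctransp E) =
      K ** (G ** (ctransp E ** (E ** (ctransp G ** ctransp K))))"
    by (simp add: mat_simps)
  also have "\<dots> = (K ** ctransp C) ** (C ** (G ** (ctransp G ** ctransp K)))"
    by (simp only: CC_G_assoc[symmetric] matrix_mul_assoc[symmetric])
  also have "\<dots> = C ** (G ** ctransp G ** ctransp K)"
    by (simp add: matrix_left_right_inverse1[OF K] matrix_mul_assoc)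
  finally have "trace (K ** G ** ctransp E ** ctransp (K ** G ** ctransp E)) =
      trace (G ** ctransp G ** (ctransp K ** C))"
    using trace_mul_sym[of C "G ** ctransp G ** ctransp K"] by (simp only: matrix_mul_assoc)
  then show "(norm (K ** G ** ctransp E))\<^sup>2 = (norm G)\<^sup>2"
    by (simp add: norm_mat_power2 \<open>ctransp K ** C = mat 1\<close>)
qed simp_all

end

section \<open>Invertibility in the disc and Gram identity on the circle\<close>

context circle_functional
begin

context
  fixes a b
  assumes a: "orthonormal_seq e a" and b: "orthonormal_seq (\<lambda>k l. e l k) b"
begin

lemma schur_step: "schur_step (leading_ratio a n) (dual_ratio b n) (schur_param a b n)"
  by unfold_locales (rule szego_recurrence(2)[OF a b] szego_recurrence_reversed(2)[OF a b])+

text \<open>Both constants normalize the same total mass \<open>M\<close>, so both Gram matrices are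
  its inverse.\<close>

lemma gram_degree_0:
  "ctransp (mat_cnj (b 0 0)) ** mat_cnj (b 0 0) = ctransp (a 0 0) ** a 0 0"
proof -
  define M where "M = ip e (\<lambda>z. mat 1) (\<lambda>z. mat 1)"
  have const: "ip e (\<lambda>z. A) (\<lambda>z. B) = A ** M ** ctransp B" for A B
    using ip_mult_right[of "\<lambda>_. A ** mat 1" "\<lambda>_. mat 1" B] ip_mult_left[of "\<lambda>_. mat 1" "\<lambda>_. mat 1" A]
    by (simp add: M_def)
  have inv: "(M ** ctransp A) ** A = mat 1" if "ip e (\<lambda>z. A) (\<lambda>z. A) = mat 1" for A
    using that matrix_left_right_inverse1[of A "M ** ctransp A"] by (simp add: const matrix_mul_assoc)
  have "M ** (ctransp (a 0 0) ** a 0 0) = mat 1"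
  proof -
    have "ip e (ev 0 (a 0)) (ev 0 (a 0)) = mat 1"
      using a by (simp add: orthonormal_seq_def)
    then show ?thesis
      using inv[of "a 0 0"] by (simp add: ev_def[abs_def] matrix_mul_assoc)
  qed
  moreover have "M ** (ctransp (mat_cnj (b 0 0)) ** mat_cnj (b 0 0)) = mat 1"
    using inv[of "mat_cnj (b 0 0)"] rev_coeff_normalized[OF b, of 0]
    by (simp add: ev_def[abs_def] rev_coeff_def matrix_mul_assoc)
  ultimately show ?thesis
    by (blast dest: matrix_inv_unique intro: trans sym)
qed

text \<open>Both claims run through one induction because the norm inequality at level
  \<open>n\<close> feeds invertibility at the next level. The outcome makes the inverse of the
  reversed polynomial analytic in the disc.\<close>

lemma rev_invertible:
  assumes "cmod z \<le> 1"
  shows "invertible (ev n (rev_coeff n (b n)) z)"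
    and "norm (ev n (a n) z *v v) \<le> norm (ev n (rev_coeff n (b n)) z *v v)"
proof (induction n arbitrary: v)
  case 0
  show "invertible (ev 0 (rev_coeff 0 (b 0)) z)"
    using b by (simp add: rev_coeff_def orthonormal_seq_def invertible_mat_cnj)
  show "norm (ev 0 (a 0) z *v v) \<le> norm (ev 0 (rev_coeff 0 (b 0)) z *v v)" for v
    by (rule power2_le_imp_le) (simp_all only: norm_mult_vec_power2 ev_degree_0 rev_coeff_def gram_degree_0 diff_self_eq_0 norm_ge_zero)
next
  case (Suc n)
  interpret schur_step "leading_ratio a n" "dual_ratio b n" "schur_param a b n"
    by (rule schur_step)
  note step = szego_recurrence(1)[OF a b, of n z] szego_recurrence_reversed(1)[OF a b, of n z]
  show "invertible (ev (Suc n) (rev_coeff (Suc n) (b (Suc n))) z)"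
    by (rule invertible_step(1)[OF step Suc(2,1) assms])
  show "norm (ev (Suc n) (a (Suc n)) z *v v) \<le> norm (ev (Suc n) (rev_coeff (Suc n) (b (Suc n))) z *v v)" for v
    by (rule invertible_step(2)[OF step Suc(2,1) assms])
qed

text \<open>For \<open>cmod z = 1\<close> the form in \<open>gram_difference\<close> is preserved
  exactly, so its vanishing at degree 0 propagates.\<close>

lemma gram_circle:
  assumes "cmod z = 1"
  shows "ctransp (ev n (rev_coeff n (b n)) z) ** ev n (rev_coeff n (b n)) z =
    ctransp (ev n (a n) z) ** ev n (a n) z"
proof (induction n)
  case 0
  show ?case by (simp only: ev_degree_0 rev_coeff_def gram_degree_0 diff_self_eq_0)
next
  case (Suc n)
  interpret schur_step "leading_ratio a n" "dual_ratio b n" "schur_param a b n"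
    by (rule schur_step)
  have "z * cnj z = 1"
    using assms by (simp add: complex_norm_square[symmetric])
  then show ?case
    using gram_difference[OF szego_recurrence(1)[OF a b, of n z] szego_recurrence_reversed(1)[OF a b, of n z]] Suc
    by simp
qed

lemma invertible_circle:
  assumes "cmod z = 1"
  shows "invertible (ev n (a n) z)"
  unfolding invertible_iff_kernel
proof (intro allI impI)
  fix v
  assume "ev n (a n) z *v v = 0"
  then have "(norm (ev n (rev_coeff n (b n)) z *v v))\<^sup>2 = 0"
    using norm_mult_vec_power2[of "ev n (a n) z" v]
    by (simp only: norm_mult_vec_power2 gram_circle[OF assms]) simp
  then show "v = 0"
    using rev_invertible(1)[of z n] assms by (simp add: invertible_iff_kernel)
qed

end

end

section \<open>Descent of orthonormality\<close>

context circle_functional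
begin

text \<open>Meant for a functional other than the one that defines the polynomials. Inverting the
  recurrence writes \<open>z *m p z\<close> and \<open>q\<close> through \<open>p'\<close> and
  \<open>q'\<close>, so the relations at level \<open>Suc k\<close> pass to level \<open>k\<close>,
  and \<open>G\<close> reappears as an inner product.\<close>

lemma orthonormality_descends:
  fixes \<alpha> \<beta> :: "nat \<Rightarrow> complex^'n^'n" and k :: nat
  defines "p \<equiv> ev k \<alpha>" and "q \<equiv> ev k \<beta>"
  assumes "schur_step C E G"
    and rec: "\<And>z. p' z = C ** (z *m p z + G ** q z)" "\<And>z. q' z = E ** (q z + z *m (ctransp G ** p z))"
    and p'_orth: "\<And>j. j \<le> k \<Longrightarrow> ip e p' (mono j) = 0"
    and q'_orth: "\<And>j. 1 \<le> j \<Longrightarrow> j \<le> Suc k \<Longrightarrow> ip e q' (mono j) = 0"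
    and p'_norm: "ip e p' p' = mat 1" and q'_norm: "ip e q' q' = mat 1"
  shows "j < k \<Longrightarrow> ip e p (mono j) = 0" "1 \<le> j \<Longrightarrow> j \<le> k \<Longrightarrow> ip e q (mono j) = 0"
    "ip e p p = mat 1" "ip e q q = mat 1" "ip e (\<lambda>z. z *m p z) q = - G"
proof -
  interpret schur_step C E G by fact
  define zp where "zp = (\<lambda>z. z *m p z)"
  have c: "cont p" "cont q" "cont zp" unfolding p_def q_def zp_def by (intro continuous_intros)+
  have c': "cont p'" "cont q'"
    using c unfolding rec[abs_def] zp_def[symmetric] by (intro continuous_intros; simp add: zp_def)+
  have zp: "zp z = ctransp C ** p' z + (- G ** ctransp E) ** q' z" for z
    using recurrence_inverse(1)[OF rec] by (simp add: zp_def mat_simps)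
  have q: "q z = ctransp E ** q' z + (- ctransp G ** ctransp C) ** p' z" for z
    using recurrence_inverse(2)[OF rec] by (simp add: mat_simps)
  have zp_left: "ip e zp F = ctransp C ** ip e p' F + (- G ** ctransp E) ** ip e q' F" if "cont F" for F
    unfolding zp[abs_def] using c' that
    by (simp only: ip_add_left ip_mult_left continuous_on_mat_mult continuous_on_const)
  have q_left: "ip e q F = ctransp E ** ip e q' F + (- ctransp G ** ctransp C) ** ip e p' F" if "cont F" for F
    unfolding q[abs_def] using c' that
    by (simp only: ip_add_left ip_mult_left continuous_on_mat_mult continuous_on_const)
  show "ip e p (mono j) = 0" if "j < k"
  proof -
    have "ip e p (mono j) = ip e zp (\<lambda>z. z *m mono j z)"
      unfolding zp_def by (rule ip_shift[symmetric]) simp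
    also have "\<dots> = ip e zp (mono (Suc j))"
      by (rule ip_cong) simp_all
    also have "\<dots> = 0"
      using that by (simp only: zp_left cont_mono) (simp add: p'_orth q'_orth del: power_Suc)
    finally show ?thesis .
  qed
  show "ip e q (mono j) = 0" if "1 \<le> j" "j \<le> k"
    using that by (simp only: q_left cont_mono) (simp add: p'_orth q'_orth)
  have p'q: "ip e p' q = 0"
    unfolding q_def using c'(1) p'_orth by (rule orthogonal_to_ev)
  \<comment> \<open>\<open>q'\<close> is orthogonal to degrees 1 to \<open>Suc k\<close> but not to
    constants; \<open>zp\<close> has no constant term.\<close>
  have "zp = ev (Suc k) (\<lambda>i. if i = 0 then 0 else \<alpha> (i - 1))"
    by (simp add: fun_eq_iff zp_def p_def ev_split_first[of "Suc k"])
      (simp add: ev_def lessThan_Suc_atMost[symmetric])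
  then have "ip e q' zp = (\<Sum>i\<le>Suc k. ip e q' (mono i) ** ctransp (if i = 0 then 0 else \<alpha> (i - 1)))"
    by (simp only: ip_ev_right c')
  also have "\<dots> = 0"
  proof (intro sum.neutral ballI)
    fix i assume "i \<in> {..Suc k}"
    then show "ip e q' (mono i) ** ctransp (if i = 0 then 0 else \<alpha> (i - 1)) = 0"
      using q'_orth[of i] by (cases "i = 0") simp_all
  qed
  finally have q'zp: "ip e q' zp = 0" .
  \<comment> \<open>Expanding one argument of the norm by the forward recurrence leaves a one-sided
    inverse of \<open>ctransp C\<close>, as the part along \<open>q\<close> is orthogonal to
    \<open>p'\<close>.\<close>
  have "mat 1 = ip e p' (\<lambda>z. C ** (zp z + G ** q z))"
    unfolding p'_norm[symmetric] by (rule ip_cong) (simp_all add: rec zp_def)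
  also have "\<dots> = ip e p' zp ** ctransp C"
    using c c' by (simp add: ip_add_right ip_mult_right continuous_on_add continuous_on_mat_mult p'q)
  finally have p'zp: "ctransp C ** ip e p' zp = mat 1"
    using matrix_left_right_inverse1 by metis
  have "mat 1 = ip e q' (\<lambda>z. E ** (q z + ctransp G ** zp z))"
    unfolding q'_norm[symmetric] by (rule ip_cong) (simp_all add: rec zp_def)
  also have "\<dots> = ip e q' q ** ctransp E"
    using c c' by (simp add: ip_add_right ip_mult_right continuous_on_add continuous_on_mat_mult q'zp)
  finally have q'q: "ctransp E ** ip e q' q = mat 1"
    using matrix_left_right_inverse1 by metis
  have "ip e p p = ip e zp zp"
    unfolding zp_def by (rule ip_shift[symmetric]) simp
  also have "\<dots> = mat 1"
    by (simp add: zp_left c p'zp q'zp)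
  finally show "ip e p p = mat 1" .
  show "ip e q q = mat 1"
    by (simp add: q_left c p'q q'q)
  show "ip e (\<lambda>z. z *m p z) q = - G"
    unfolding zp_def[symmetric]
    by (simp add: zp_left c p'q q'q matrix_mul_distrib matrix_mul_assoc[symmetric])
qed

end

subsection \<open>Bernstein-Szego weights\<close>

definition weight_functional ::
    "(complex \<Rightarrow> complex^'n^'n) \<Rightarrow> 'n \<Rightarrow> 'n \<Rightarrow> (complex \<Rightarrow> complex) \<Rightarrow> complex" where
  "weight_functional w k l f = 1 / (2 * pi) * integral {0..2 * pi} (\<lambda>t. f (cis t) * w (cis t) $ k $ l)"

lemma cont_cis: "cont f \<Longrightarrow> continuous_on S (\<lambda>t. f (cis t))"
  by (rule continuous_on_compose2[where g = f and f = cis]) (auto intro: continuous_intros)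

lemma integrable_cis:
  fixes f :: "complex \<Rightarrow> 'b::banach"
  shows "cont f \<Longrightarrow> (\<lambda>t. f (cis t)) integrable_on {0..2 * pi}"
  by (intro integrable_continuous_real cont_cis)

lemma circle_functional_weight:
  assumes w: "cont w" and herm: "\<And>z. cmod z = 1 \<Longrightarrow> ctransp (w z) = w z"
  shows "circle_functional (weight_functional w)"
proof
  have w': "cont (\<lambda>z. w z $ k $ l)" for k l
    using w by (intro continuous_intros)
  fix f g :: "complex \<Rightarrow> complex" and k l and c :: complex
  show "weight_functional w k l (\<lambda>z. f z + g z) = weight_functional w k l f + weight_functional w k l g"
    if "cont f" "cont g"
    using that w' integrable_cis[of "\<lambda>z. f z * w z $ k $ l"] integrable_cis[of "\<lambda>z. g z * w z $ k $ l"]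
    by (simp add: weight_functional_def distrib_right continuous_on_mult integral_add add_divide_distrib)
  show "weight_functional w k l (\<lambda>z. c * f z) = c * weight_functional w k l f"
    by (simp add: weight_functional_def mult.assoc)
  show "weight_functional w k l f = weight_functional w k l g" if "\<And>z. cmod z = 1 \<Longrightarrow> f z = g z"
    using that by (simp add: weight_functional_def)
  have "cnj (w (cis t) $ k $ l) = w (cis t) $ l $ k" for t k l
    using arg_cong[OF herm[of "cis t"], of "\<lambda>A. A $ l $ k"] by simp
  then show "weight_functional w k l (\<lambda>z. cnj (f z)) = cnj (weight_functional w l k f)"
    by (simp add: weight_functional_def Henstock_Kurzweil_Integration.integral_cnj)
qed

lemma ip_weight_functional:
  assumes "cont w" "cont F" "cont G"
  shows "ip (weight_functional w) F G $ i $ j =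
    1 / (2 * pi) * integral {0..2 * pi} (\<lambda>t. (F (cis t) ** w (cis t) ** ctransp (G (cis t))) $ i $ j)"
proof -
  have c: "cont (\<lambda>z. F z $ i $ k)" "cont (\<lambda>z. cnj (G z $ j $ k))" "cont (\<lambda>z. w z $ k $ l)" for i j k l
    by (intro continuous_intros assms)+
  have "(F z ** w z ** ctransp (G z)) $ i $ j =
      (\<Sum>k\<in>UNIV. \<Sum>l\<in>UNIV. F z $ i $ k * cnj (G z $ j $ l) * w z $ k $ l)" for z
    unfolding matrix_mul_nth ctransp_nth sum_distrib_right
    by (subst sum.swap) (simp add: mult_ac)
  moreover have "integral {0..2 * pi} (\<lambda>t. \<Sum>k\<in>UNIV. \<Sum>l\<in>UNIV.
        F (cis t) $ i $ k * cnj (G (cis t) $ j $ l) * w (cis t) $ k $ l) =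
      (\<Sum>k\<in>UNIV. \<Sum>l\<in>UNIV. integral {0..2 * pi} (\<lambda>t.
        F (cis t) $ i $ k * cnj (G (cis t) $ j $ l) * w (cis t) $ k $ l))"
  proof -
    have "(\<lambda>t. F (cis t) $ i $ k * cnj (G (cis t) $ j $ l) * w (cis t) $ k $ l) integrable_on {0..2 * pi}" for k l
      by (rule integrable_cis[of "\<lambda>z. F z $ i $ k * cnj (G z $ j $ l) * w z $ k $ l"])
        (intro continuous_on_mult c)
    then show ?thesis
      by (simp add: integral_sum integrable_sum)
  qed
  ultimately show ?thesis
    by (simp add: ip_def weight_functional_def sum_distrib_left)
qed

text \<open>Cauchy's theorem on the closed disc: the factor \<open>cis t\<close> comes from dz = i z
  dt.\<close>

lemma integral_cis_mult_holomorphic: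
  assumes "continuous_on (cball 0 1) f" "f holomorphic_on ball 0 1"
  shows "integral {0..2 * pi} (\<lambda>t. cis t * f (cis t)) = 0"
proof -
  have "f field_differentiable at z" if "z \<in> ball 0 1" for z
    using assms(2) that holomorphic_on_imp_differentiable_at by blast
  then have "(f has_contour_integral 0) (circlepath 0 1)"
    using assms(1) by (intro Cauchy_theorem_convex[where S = "cball 0 1" and K = "{}"]) auto
  then have "0 = contour_integral (part_circlepath 0 1 0 (2 * pi)) f"
    by (simp add: contour_integral_unique circlepath_def)
  also have "\<dots> = integral {0..2 * pi} (\<lambda>t. f (cis t) * \<i> * cis t)"
    by (subst contour_integral_part_circlepath_eq) simp_all
  also have "\<dots> = \<i> * integral {0..2 * pi} (\<lambda>t. cis t * f (cis t))"
    by (subst integral_mult_right[symmetric]) (simp add: mult_ac)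
  finally show ?thesis by simp
qed

definition szego_weight :: "(nat \<Rightarrow> nat \<Rightarrow> complex^'n^'n) \<Rightarrow> nat \<Rightarrow> complex \<Rightarrow> complex^'n^'n" where
  "szego_weight a m z = matrix_inv (ev m (a m) z) ** ctransp (matrix_inv (ev m (a m) z))"

lemma matrix_inv_gram:
  fixes A :: "complex^'n^'n"
  assumes "invertible A"
  shows "matrix_inv (ctransp A ** A) = matrix_inv A ** ctransp (matrix_inv A)"
  using assms by (simp add: matrix_inv_mult invertible_ctransp matrix_inv_ctransp)

section \<open>Orthonormality with respect to the weights\<close>

context circle_functional
begin

context
  fixes a b
  assumes a: "orthonormal_seq e a" and b: "orthonormal_seq (\<lambda>k l. e l k) b"
begin

text \<open>The weight is the inverse of a Gram matrix, and by \<open>gram_circle\<close> both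
  polynomials have the same one.\<close>

lemma szego_weight_rev:
  assumes z: "cmod z = 1"
  shows "szego_weight a m z =
    matrix_inv (ev m (rev_coeff m (b m)) z) ** ctransp (matrix_inv (ev m (rev_coeff m (b m)) z))"
  using z invertible_circle[OF a b z, of m] rev_invertible(1)[OF a b, of z m] gram_circle[OF a b z, of m]
  by (simp add: szego_weight_def matrix_inv_gram[symmetric])

text \<open>Reversing the polynomial of \<open>a\<close> gives \<open>z ^ n\<close> times its
  conjugate on the circle. This trades an adjoint for a function that is analytic in the disc by the
  dual of \<open>rev_invertible\<close>.\<close>

lemma ctransp_inv_circle:
  assumes z: "cmod z = 1"
  shows "ctransp (matrix_inv (ev n (a n) z)) = z ^ n *m transpose (matrix_inv (ev n (rev_coeff n (a n)) z))"
proof -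
  have inv: "invertible (ev n (a n) z)"
    using invertible_circle[OF a b z] .
  have zz: "z ^ n * cnj z ^ n = 1"
    using z by (simp add: power_mult_distrib[symmetric] complex_norm_square[symmetric])
  have "matrix_inv (ev n (rev_coeff n (a n)) z) = cnj z ^ n *m mat_cnj (matrix_inv (ev n (a n) z))"
  proof (rule matrix_inv_unique)
    show "ev n (rev_coeff n (a n)) z ** (cnj z ^ n *m mat_cnj (matrix_inv (ev n (a n) z))) = mat 1"
      using arg_cong[OF invertible_matrix_inv(1)[OF inv], of mat_cnj]
      by (simp add: ev_rev_coeff_circle[OF z] zz mult.commute)
  qed
  then show ?thesis by (simp add: zz vec_eq_iff mult.assoc[symmetric])
qed

lemma cont_szego_weight: "cont (szego_weight a m)"
  unfolding szego_weight_def[abs_def]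
  by (intro continuous_intros continuous_on_matrix_inv) (simp_all add: invertible_circle[OF a b])

lemma circle_functional_szego: "circle_functional (weight_functional (szego_weight a m))"
  by (rule circle_functional_weight[OF cont_szego_weight]) (simp add: szego_weight_def ctransp_mult)

text \<open>The inverse of a reversed polynomial is analytic in the disc, so Cauchy's theorem
  applies. The functional is a parameter to cover both \<open>e\<close> and its dual.\<close>

lemma integral_rev_inverse:
  assumes c: "orthonormal_seq e' c" "orthonormal_seq (\<lambda>k l. e' l k) d" "circle_functional e'" and "j \<ge> 1"
  shows "integral {0..2 * pi} (\<lambda>t. cis t ^ j * matrix_inv (ev m (rev_coeff m (d m)) (cis t)) $ r $ s) = 0"
proof -
  let ?q = "ev m (rev_coeff m (d m))"
  have inv: "invertible (?q z)" if "cmod z \<le> 1" for z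
    using circle_functional.rev_invertible(1)[OF c(3,1,2) that] .
  obtain i where j: "j = Suc i"
    using \<open>j \<ge> 1\<close> by (cases j) auto
  have "integral {0..2 * pi} (\<lambda>t. cis t * (cis t ^ i * matrix_inv (?q (cis t)) $ r $ s)) = 0"
  proof (rule integral_cis_mult_holomorphic)
    have "continuous_on (cball 0 1) (\<lambda>z. matrix_inv (?q z))"
      by (intro continuous_on_matrix_inv continuous_intros) (simp add: inv)
    then show "continuous_on (cball 0 1) (\<lambda>z. z ^ i * matrix_inv (?q z) $ r $ s)"
      by (intro continuous_intros)
    show "(\<lambda>z. z ^ i * matrix_inv (?q z) $ r $ s) holomorphic_on ball 0 1"
      by (intro holomorphic_intros holomorphic_on_matrix_inv holomorphic_on_ev) (simp add: inv)
  qed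
  then show ?thesis by (simp add: j mult.assoc)
qed

text \<open>The weight cancels the left polynomial and leaves its inverse adjoint. Against a
  monomial this is a positive power of \<open>z\<close> times an analytic function, or the conjugate
  of one, so its mean is 0; against the polynomial itself it is the identity.\<close>

lemma szego_weight_orthonormal:
  fixes m
  defines "e' \<equiv> weight_functional (szego_weight a m)"
  shows "j < m \<Longrightarrow> ip e' (ev m (a m)) (mono j) = 0"
    and "1 \<le> j \<Longrightarrow> j \<le> m \<Longrightarrow> ip e' (ev m (rev_coeff m (b m))) (mono j) = 0"
    and "ip e' (ev m (a m)) (ev m (a m)) = mat 1"
    and "ip e' (ev m (rev_coeff m (b m))) (ev m (rev_coeff m (b m))) = mat 1"
proof -
  let ?p = "ev m (a m)" and ?q = "ev m (rev_coeff m (b m))" and ?r = "ev m (rev_coeff m (a m))"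
  \<comment> \<open>The dual of the dual is \<open>e\<close>, in the shape needed to use
    \<open>integral_rev_inverse\<close> with \<open>a\<close> and \<open>b\<close>
    exchanged.\<close>
  have dual': "orthonormal_seq (\<lambda>k l. (\<lambda>k l. e l k) l k) a" using a by simp
  have p: "?p z ** matrix_inv (?p z) = mat 1" if "cmod z = 1" for z
    using invertible_circle[OF a b that] by (rule invertible_matrix_inv)
  have q: "?q z ** matrix_inv (?q z) = mat 1" if "cmod z = 1" for z
    using rev_invertible(1)[OF a b, of z m] that by (intro invertible_matrix_inv) simp
  have ip: "ip e' F G $ r $ s = 1 / (2 * pi) * integral {0..2 * pi}
      (\<lambda>t. (F (cis t) ** szego_weight a m (cis t) ** ctransp (G (cis t))) $ r $ s)" if "cont F" "cont G" for F G r s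
    unfolding e'_def using cont_szego_weight that by (rule ip_weight_functional)
  have c: "cont (ev n d)" for n and d :: "nat \<Rightarrow> complex^'n^'n" by (intro continuous_intros)
  have zz: "z ^ m * cnj z ^ j = z ^ (m - j)" if "cmod z = 1" "j \<le> m" for z j
  proof -
    have "z ^ j * cnj z ^ j = 1"
      using that by (simp add: power_mult_distrib[symmetric] complex_norm_square[symmetric])
    then have "z ^ (m - j) * (z ^ j * cnj z ^ j) = z ^ (m - j)" by simp
    then show ?thesis using that by (simp add: mult.assoc[symmetric] power_add[symmetric])
  qed
  have pw: "?p z ** szego_weight a m z = ctransp (matrix_inv (?p z))" if "cmod z = 1" for z
    using p[OF that] by (simp add: szego_weight_def matrix_mul_assoc)
  have qw: "?q z ** szego_weight a m z = ctransp (matrix_inv (?q z))" if "cmod z = 1" for z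
    using q[OF that] that by (simp add: szego_weight_rev matrix_mul_assoc)
  show "ip e' ?p (mono j) = 0" if "j < m"
  proof -
    have "(?p z ** szego_weight a m z ** ctransp (mono j z)) $ r $ s = z ^ (m - j) * matrix_inv (?r z) $ s $ r"
      if "cmod z = 1" for z r s
      using zz[of z j] that \<open>j < m\<close> by (simp add: pw ctransp_inv_circle mult.assoc[symmetric] mult.commute)
    then show ?thesis
      using integral_rev_inverse[OF b dual' dual, of "m - j" m] that
      by (simp add: vec_eq_iff ip c cont_mono)
  qed
  show "ip e' ?q (mono j) = 0" if "1 \<le> j" "j \<le> m"
  proof -
    have "(?q z ** szego_weight a m z ** ctransp (mono j z)) $ r $ s = cnj (z ^ j * matrix_inv (?q z) $ s $ r)"
      if "cmod z = 1" for z r s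
      using that by (simp add: qw)
    then show ?thesis
      using integral_rev_inverse[OF a b circle_functional_axioms that(1), of m]
      by (simp add: vec_eq_iff ip c cont_mono Henstock_Kurzweil_Integration.integral_cnj[symmetric] del: complex_cnj_mult)
  qed
  show "ip e' ?p ?p = mat 1"
  proof -
    have "?p z ** szego_weight a m z ** ctransp (?p z) = mat 1" if "cmod z = 1" for z
      using arg_cong[OF p[OF that], of ctransp] that by (simp add: pw ctransp_mult)
    then show ?thesis
      by (simp add: vec_eq_iff ip c scaleR_conv_of_real)
  qed
  show "ip e' ?q ?q = mat 1"
  proof -
    have "?q z ** szego_weight a m z ** ctransp (?q z) = mat 1" if "cmod z = 1" for z
      using arg_cong[OF q[OF that], of ctransp] that by (simp add: qw ctransp_mult)
    then show ?thesis
      by (simp add: vec_eq_iff ip c scaleR_conv_of_real)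
  qed
qed

text \<open>The polynomials satisfy the same recurrences whichever functional is used, so
  orthonormality for the weight descends from level \<open>m\<close>.\<close>

lemma schur_param_szego_weight:
  assumes "n < m"
  shows "ip (weight_functional (szego_weight a m)) (\<lambda>z. z *m ev n (a n) z) (ev n (rev_coeff n (b n))) =
    - schur_param a b n"
proof -
  define e' where "e' = weight_functional (szego_weight a m)"
  define ok where "ok k \<longleftrightarrow>
    (\<forall>j<k. ip e' (ev k (a k)) (mono j) = 0) \<and>
    (\<forall>j. 1 \<le> j \<longrightarrow> j \<le> k \<longrightarrow> ip e' (ev k (rev_coeff k (b k))) (mono j) = 0) \<and>
    ip e' (ev k (a k)) (ev k (a k)) = mat 1 \<and>
    ip e' (ev k (rev_coeff k (b k))) (ev k (rev_coeff k (b k))) = mat 1" for k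
  interpret e': circle_functional e'
    unfolding e'_def by (rule circle_functional_szego)
  have top: "ok m"
    unfolding ok_def e'_def by (auto simp: szego_weight_orthonormal)
  note step = e'.orthonormality_descends[OF schur_step[OF a b] szego_recurrence(1)[OF a b]
      szego_recurrence_reversed(1)[OF a b]]
  have hyps: "j \<le> k \<Longrightarrow> ip e' (ev (Suc k) (a (Suc k))) (mono j) = 0"
    "1 \<le> j \<Longrightarrow> j \<le> Suc k \<Longrightarrow> ip e' (ev (Suc k) (rev_coeff (Suc k) (b (Suc k)))) (mono j) = 0"
    "ip e' (ev (Suc k) (a (Suc k))) (ev (Suc k) (a (Suc k))) = mat 1"
    "ip e' (ev (Suc k) (rev_coeff (Suc k) (b (Suc k)))) (ev (Suc k) (rev_coeff (Suc k) (b (Suc k)))) = mat 1"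
    if "ok (Suc k)" for k j
    using that unfolding ok_def by (simp_all add: less_Suc_eq_le)
  have down: "ok k" if "ok (Suc k)" for k
    unfolding ok_def
    using step(1)[OF hyps[OF that]] step(2)[OF hyps[OF that]] step(3)[OF hyps[OF that]] step(4)[OF hyps[OF that]]
    by blast
  \<comment> \<open>The induction stops at \<open>Suc n\<close>, since the last descent to
    \<open>n\<close> itself delivers the inner product sought.\<close>
  have "Suc n \<le> m" using assms by simp
  then have "ok (Suc n)"
    using top by (induction rule: inc_induct) (auto intro: down)
  from step(5)[OF hyps[OF this]] show ?thesis
    unfolding e'_def .
qed

end

end

section \<open>Estimates between \<open>schur_param\<close> and \<open>defect\<close>, the matrix
  inside the norm of the theorem\<close>

definition defect :: "(nat \<Rightarrow> nat \<Rightarrow> complex^'n^'n) \<Rightarrow> nat \<Rightarrow> nat \<Rightarrow> complex \<Rightarrow> complex^'n^'n" where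
  "defect a n m z = ev n (a n) z ** szego_weight a m z ** ctransp (ev n (a n) z) - mat 1"

context circle_functional
begin

context
  fixes a b
  assumes a: "orthonormal_seq e a" and b: "orthonormal_seq (\<lambda>k l. e l k) b"
begin

lemma cont_defect: "cont (defect a n m)"
  unfolding defect_def[abs_def] by (intro continuous_intros cont_szego_weight[OF a b])

lemma cmod_schur_param_le:
  assumes "n < m"
  shows "cmod (schur_param a b n $ i $ j) \<le> 1 / (2 * pi) * integral {0..2 * pi} (\<lambda>t. spectral_norm (defect a n m (cis t)))"
proof -
  let ?p = "ev n (a n)" and ?q = "ev n (rev_coeff n (b n))" and ?r = "ev n (rev_coeff n (a n))"
  \<comment> \<open>This form is visibly analytic in the disc; on the circle it equals the unitary
    \<open>ctransp (?q z ** matrix_inv (?p z))\<close>.\<close>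
  define V where "V z = transpose (matrix_inv (?r z)) ** transpose (ev n (b n) z)" for z
  have inv_r: "invertible (?r z)" if "cmod z \<le> 1" for z
    using circle_functional.rev_invertible(1)[OF dual b, of a z n] a that by simp
  have V: "V z = ctransp (?q z ** matrix_inv (?p z))" if z: "cmod z = 1" for z
  proof -
    have "z ^ n * cnj z ^ n = 1"
      using z by (simp add: power_mult_distrib[symmetric] complex_norm_square[symmetric])
    then show ?thesis
      by (simp add: V_def ctransp_mult ctransp_inv_circle[OF a b z] ev_rev_coeff_circle[OF z] mult.commute)
  qed
  have V_isometry: "norm (V z *v x) = norm x" if z: "cmod z = 1" for z x
  proof -
    have q: "?q z ** matrix_inv (?q z) = mat 1"
      using rev_invertible(1)[OF a b, of z n] z by (intro invertible_matrix_inv) simp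
    have "ctransp (V z) ** V z = ?q z ** szego_weight a n z ** ctransp (?q z)"
      using z by (simp add: V ctransp_mult szego_weight_def matrix_mul_assoc)
    also have "\<dots> = mat 1"
    proof -
      have "ctransp (matrix_inv (?q z)) ** ctransp (?q z) = mat 1"
        by (simp add: ctransp_mult[symmetric] q)
      then show ?thesis
        using q by (simp add: szego_weight_rev[OF a b z] matrix_mul_assoc)
    qed
    finally have VV: "ctransp (V z) ** V z = mat 1" .
    have "(norm (V z *v x))\<^sup>2 = inner x x"
      unfolding norm_mult_vec_power2 VV by simp
    then show ?thesis by (simp add: power2_norm_eq_inner[symmetric])
  qed
  have "continuous_on (cball 0 1) (\<lambda>z. matrix_inv (?r z))"
    by (intro continuous_on_matrix_inv continuous_intros) (simp add: inv_r)
  then have cV': "continuous_on (cball 0 1) V"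
    unfolding V_def[abs_def] by (intro continuous_intros)
  then have cV: "cont V" by (rule continuous_on_subset) auto
  have "(\<lambda>z. V z $ i $ j) holomorphic_on ball 0 1"
    unfolding V_def matrix_mul_nth transpose_nth
    by (intro holomorphic_intros holomorphic_on_matrix_inv holomorphic_on_ev) (simp add: inv_r)
  with cV' have V_zero: "integral {0..2 * pi} (\<lambda>t. cis t * V (cis t) $ i $ j) = 0"
    by (intro integral_cis_mult_holomorphic continuous_intros)
  \<comment> \<open>\<open>W\<close> is the part of the integrand carrying the defect; the rest,
    \<open>z * V z $ i $ j\<close>, has mean 0.\<close>
  define W where "W z = z * (defect a n m z ** V z) $ i $ j" for z
  have cW: "cont W"
    unfolding W_def[abs_def] by (intro continuous_intros cont_defect cV)
  have eq: "z * (?p z ** szego_weight a m z ** ctransp (?q z)) $ i $ j = W z + z * V z $ i $ j" if z: "cmod z = 1" for z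
  proof -
    have "ctransp (?p z) ** V z = ctransp (?q z)"
      using invertible_matrix_inv(2)[OF invertible_circle[OF a b z, of n]]
      by (simp add: V[OF z] ctransp_mult[symmetric] matrix_mul_assoc[symmetric])
    then have "?p z ** szego_weight a m z ** ctransp (?q z) = defect a n m z ** V z + V z"
      by (simp add: defect_def mat_simps)
    then show ?thesis
      by (simp add: W_def algebra_simps)
  qed
  have "- schur_param a b n $ i $ j =
      1 / (2 * pi) * integral {0..2 * pi} (\<lambda>t. W (cis t) + cis t * V (cis t) $ i $ j)"
    using arg_cong[OF schur_param_szego_weight[OF a b assms], of "\<lambda>A. A $ i $ j"]
    by (subst (asm) ip_weight_functional) (auto intro!: cont_szego_weight[OF a b] continuous_intros simp: eq)
  also have "integral {0..2 * pi} (\<lambda>t. W (cis t) + cis t * V (cis t) $ i $ j) = integral {0..2 * pi} (\<lambda>t. W (cis t))"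
    using V_zero integrable_cis[OF cW] integrable_cis[of "\<lambda>z. z * V z $ i $ j"]
    by (simp add: integral_add continuous_intros cV)
  finally have "cmod (- schur_param a b n $ i $ j) =
      cmod (1 / (2 * pi) * integral {0..2 * pi} (\<lambda>t. W (cis t)))"
    by (rule arg_cong)
  then have "cmod (schur_param a b n $ i $ j) = 1 / (2 * pi) * cmod (integral {0..2 * pi} (\<lambda>t. W (cis t)))"
    by (simp add: norm_mult norm_divide)
  also have "\<dots> \<le> 1 / (2 * pi) * integral {0..2 * pi} (\<lambda>t. spectral_norm (defect a n m (cis t)))"
  proof (intro mult_left_mono integral_norm_bound_integral)
    show "(\<lambda>t. W (cis t)) integrable_on {0..2 * pi}"
      by (rule integrable_cis[OF cW])
    show "(\<lambda>t. spectral_norm (defect a n m (cis t))) integrable_on {0..2 * pi}"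
      by (rule integrable_cis[OF continuous_on_spectral_norm[OF cont_defect]])
    fix t
    have "(defect a n m (cis t) ** V (cis t)) $ i $ j = ((defect a n m (cis t) ** V (cis t)) *v axis j 1) $ i"
      by (simp add: matrix_vector_mult_def axis_def if_distrib cong: if_cong)
    then have "cmod (W (cis t)) \<le> norm ((defect a n m (cis t) ** V (cis t)) *v axis j 1)"
      by (simp add: W_def norm_mult component_le_norm_cart Finite_Cartesian_Product.norm_nth_le)
    also have "\<dots> \<le> spectral_norm (defect a n m (cis t)) * norm (V (cis t) *v axis j 1)"
      unfolding matrix_vector_mul_assoc[symmetric] by (rule spectral_norm_vec_le)
    also have "\<dots> = spectral_norm (defect a n m (cis t))"
      by (simp add: V_isometry norm_axis_1)
    finally show "norm (W (cis t)) \<le> spectral_norm (defect a n m (cis t))" .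
  qed simp
  finally show ?thesis .
qed

text \<open>With \<open>U = q ** matrix_inv p\<close> unitary,
  \<open>N = z *m mat 1 + G ** U\<close> is a perturbation of a unimodular scalar. Its inverse
  \<open>P\<close> gives the defect as \<open>- (P ** Z ** ctransp P)\<close> with \<open>Z\<close>
  of size at most \<open>2 * g + 2 * g\<^sup>2\<close>.\<close>

lemma spectral_norm_defect_Suc_le:
  assumes z: "cmod z = 1" and g: "norm (schur_param a b n) < 1"
  defines "g \<equiv> norm (schur_param a b n)"
  shows "spectral_norm (defect a n (Suc n) z) \<le> (2 * g + 2 * g\<^sup>2) / (1 - g)\<^sup>2"
proof -
  define p q G C B where "p = ev n (a n) z" and "q = ev n (rev_coeff n (b n)) z"
    and "G = schur_param a b n" and "C = leading_ratio a n" and "B = ev (Suc n) (a (Suc n)) z"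
  interpret schur_step C "dual_ratio b n" G
    unfolding C_def G_def by (rule schur_step[OF a b])
  have B: "B = C ** (z *m p + G ** q)"
    unfolding B_def C_def G_def p_def q_def by (rule szego_recurrence(1)[OF a b])
  have p: "p ** matrix_inv p = mat 1" "matrix_inv p ** p = mat 1"
    unfolding p_def using invertible_circle[OF a b z] by (rule invertible_matrix_inv)+
  have BB: "matrix_inv B ** B = mat 1"
    unfolding B_def using invertible_circle[OF a b z] by (rule invertible_matrix_inv)
  have CK: "C ** matrix_inv C = mat 1" "matrix_inv C ** C = mat 1"
    using invertible_C by (rule invertible_matrix_inv)+
  define U where "U = q ** matrix_inv p"
  have "ctransp U ** U = ctransp (matrix_inv p) ** (ctransp q ** q) ** matrix_inv p"
    by (simp add: U_def mat_simps)
  also have "ctransp q ** q = ctransp p ** p"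
    unfolding p_def q_def by (rule gram_circle[OF a b z])
  also have "ctransp (matrix_inv p) ** (ctransp p ** p) ** matrix_inv p =
      ctransp (p ** matrix_inv p) ** (p ** matrix_inv p)"
    by (simp add: mat_simps)
  finally have U: "ctransp U ** U = mat 1" by (simp add: p)
  then have U': "U ** ctransp U = mat 1" by (rule matrix_left_right_inverse1)
  have U_isometry: "norm (U *v x) = norm x" "norm (ctransp U *v x) = norm x" for x
    using norm_mult_vec_power2[of U x] norm_mult_vec_power2[of "ctransp U" x]
    by (simp_all add: U U' power2_norm_eq_inner[symmetric])
  have zz: "z * cnj z = 1"
    using z by (simp add: complex_norm_square[symmetric])
  define N where "N = z *m mat 1 + G ** U"
  define P where "P = p ** (matrix_inv B ** C)"
  have CN: "C ** N = B ** matrix_inv p"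
    unfolding B N_def U_def by (simp add: mat_simps p)
  have PN: "P ** N = mat 1"
  proof -
    have "P ** N = p ** (matrix_inv B ** (C ** N))"
      by (simp add: P_def matrix_mul_assoc)
    also have "\<dots> = p ** ((matrix_inv B ** B) ** matrix_inv p)"
      by (simp only: CN matrix_mul_assoc)
    finally show ?thesis by (simp add: BB p)
  qed
  then have NP: "N ** P = mat 1" by (rule matrix_left_right_inverse1)
  have NP': "ctransp N ** ctransp P = mat 1"
    using arg_cong[OF PN, of ctransp] by (simp add: ctransp_mult)
  have G_le: "norm (G *v x) \<le> g * norm x" "norm (ctransp G *v x) \<le> g * norm x" for x
    using norm_mat_vec_le[of G x] norm_mat_vec_le[of "ctransp G" x]
    by (simp_all add: g_def G_def norm_ctransp)
  have g0: "0 \<le> g" "g < 1" using g by (simp_all add: g_def)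
  have z_mult: "norm (z *s x) = norm x" "norm (cnj z *s x) = norm x" for x :: "complex^'n"
    using z by (simp_all add: norm_scale_vec)
  \<comment> \<open>From \<open>x = N *v y\<close> follows
    \<open>norm x \<ge> norm y - g * norm y\<close>.\<close>
  have P_le: "norm (P *v x) \<le> norm x / (1 - g)" for x
  proof -
    define y where "y = P *v x"
    have "x = N *v y"
      by (simp add: y_def matrix_vector_mul_assoc NP)
    also have "\<dots> = z *s y + G *v (U *v y)"
      by (simp add: N_def matrix_vector_mult_add_rdistrib scale_mat_vec matrix_vector_mul_assoc[symmetric])
    finally have "norm (z *s y) \<le> norm x + norm (G *v (U *v y))"
      by (metis add_diff_cancel_right' norm_triangle_ineq4)
    also have "norm (G *v (U *v y)) \<le> g * norm y"
      using G_le(1)[of "U *v y"] by (simp add: U_isometry)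
    finally have "(1 - g) * norm y \<le> norm x"
      by (simp add: z_mult algebra_simps)
    then show ?thesis using g0 by (simp add: y_def pos_le_divide_eq mult.commute)
  qed
  have P'_le: "norm (ctransp P *v x) \<le> norm x / (1 - g)" for x
  proof -
    define y where "y = ctransp P *v x"
    have "x = ctransp N *v y"
      by (simp add: y_def matrix_vector_mul_assoc NP')
    also have "\<dots> = cnj z *s y + ctransp U *v (ctransp G *v y)"
      by (simp add: N_def ctransp_mult matrix_vector_mult_add_rdistrib scale_mat_vec matrix_vector_mul_assoc[symmetric])
    finally have "norm (cnj z *s y) \<le> norm x + norm (ctransp U *v (ctransp G *v y))"
      by (metis add_diff_cancel_right' norm_triangle_ineq4)
    also have "norm (ctransp U *v (ctransp G *v y)) \<le> g * norm y"
      using G_le(2)[of y] by (simp add: U_isometry)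
    finally have "(1 - g) * norm y \<le> norm x"
      by (simp add: z_mult algebra_simps)
    then show ?thesis using g0 by (simp add: y_def pos_le_divide_eq mult.commute)
  qed
  \<comment> \<open>\<open>Z\<close> is \<open>N ** ctransp N\<close> minus
    \<open>mat 1 - G ** ctransp G\<close>; the constant terms cancel, so each term left contains
    \<open>G\<close> or its adjoint.\<close>
  define Z where "Z = z *m (ctransp U ** ctransp G) + cnj z *m (G ** U) + 2 *m (G ** ctransp G)"
  have Z_le: "norm (Z *v x) \<le> (2 * g + 2 * g\<^sup>2) * norm x" for x
  proof -
    have "Z *v x = z *s (ctransp U *v (ctransp G *v x)) + cnj z *s (G *v (U *v x)) + 2 *s (G *v (ctransp G *v x))"
      by (simp add: Z_def matrix_vector_mult_add_rdistrib scale_mat_vec matrix_vector_mul_assoc[symmetric])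
    also have "norm \<dots> \<le> norm (ctransp G *v x) + norm (G *v (U *v x)) + 2 * norm (G *v (ctransp G *v x))"
      by (intro order_trans[OF norm_triangle_ineq] add_mono) (simp_all add: z U_isometry norm_scale_vec)
    also have "\<dots> \<le> g * norm x + g * norm x + 2 * (g * (g * norm x))"
      using G_le(1)[of "U *v x"] G_le(2)[of x] order_trans[OF G_le(1) mult_left_mono[OF G_le(2) g0(1)], of x]
      by (simp add: U_isometry)
    finally show ?thesis by (simp add: algebra_simps power2_eq_square)
  qed
  have CKK: "matrix_inv C ** ctransp (matrix_inv C) = mat 1 - G ** ctransp G"
  proof -
    have "matrix_inv C ** ctransp (matrix_inv C) =
        matrix_inv C ** (C ** (mat 1 - G ** ctransp G) ** ctransp C) ** ctransp (matrix_inv C)"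
      by (simp add: C)
    also have "\<dots> = (matrix_inv C ** C) ** (mat 1 - G ** ctransp G) ** ctransp (matrix_inv C ** C)"
      by (simp only: ctransp_mult matrix_mul_assoc)
    finally show ?thesis by (simp add: CK)
  qed
  have pB: "p ** matrix_inv B = P ** matrix_inv C"
    by (simp add: P_def matrix_mul_assoc[symmetric] CK)
  have NN: "N ** ctransp N = mat 1 + z *m (ctransp U ** ctransp G) + cnj z *m (G ** U) + G ** ctransp G"
    by (simp add: N_def mat_simps zz matrix_cancel[OF U'] mult.commute)
  have "defect a n (Suc n) z + mat 1 = (p ** matrix_inv B) ** ctransp (p ** matrix_inv B)"
    by (simp add: defect_def szego_weight_def p_def B_def ctransp_mult matrix_mul_assoc)
  also have "\<dots> = P ** (mat 1 - G ** ctransp G) ** ctransp P"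
    unfolding pB CKK[symmetric] by (simp add: ctransp_mult matrix_mul_assoc)
  finally have d1: "defect a n (Suc n) z = P ** (mat 1 - G ** ctransp G) ** ctransp P - mat 1"
    by (simp add: eq_diff_eq)
  \<comment> \<open>The identity is put between the factors \<open>P\<close> as well, so that the
    subtraction takes place inside.\<close>
  have "mat 1 = (P ** N) ** ctransp (P ** N)"
    by (simp add: PN)
  also have "\<dots> = P ** (N ** ctransp N) ** ctransp P"
    by (simp only: ctransp_mult matrix_mul_assoc)
  finally have d2: "mat 1 = P ** (N ** ctransp N) ** ctransp P" .
  have "defect a n (Suc n) z = P ** ((mat 1 - G ** ctransp G) - N ** ctransp N) ** ctransp P"
    unfolding d1 by (subst (2) d2) (simp only: matrix_mul_distrib)
  also have "(mat 1 - G ** ctransp G) - N ** ctransp N = - Z"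
    unfolding NN Z_def by (simp add: vec_eq_iff)
  finally have d: "defect a n (Suc n) z = - (P ** Z ** ctransp P)"
    by (simp add: matrix_mul_distrib)
  show ?thesis
  proof (rule spectral_norm_le)
    fix x
    have "norm (defect a n (Suc n) z *v x) = norm (P *v (Z *v (ctransp P *v x)))"
      unfolding d using matrix_vector_mult_diff_rdistrib[of 0 "P ** Z ** ctransp P" x]
      by (simp add: matrix_vector_mul_assoc matrix_mul_assoc)
    also have "\<dots> \<le> norm (Z *v (ctransp P *v x)) / (1 - g)"
      by (rule P_le)
    also have "\<dots> \<le> (2 * g + 2 * g\<^sup>2) * norm (ctransp P *v x) / (1 - g)"
      using g0 by (intro divide_right_mono Z_le) simp
    also have "\<dots> \<le> (2 * g + 2 * g\<^sup>2) * (norm x / (1 - g)) / (1 - g)"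
      using g0 by (intro divide_right_mono mult_left_mono P'_le) auto
    also have "\<dots> = (2 * g + 2 * g\<^sup>2) / (1 - g)\<^sup>2 * norm x"
      by (simp add: power2_eq_square)
    finally show "norm (defect a n (Suc n) z *v x) \<le> (2 * g + 2 * g\<^sup>2) / (1 - g)\<^sup>2 * norm x" .
  qed
qed

text \<open>At \<open>z = 0\<close> the dual recurrence expresses \<open>b (Suc n) 0\<close> through
  \<open>G\<close> and \<open>a n n\<close>. The factors \<open>a n n\<close> cancel, and
  \<open>norm_reflection\<close> treats what is left.\<close>

lemma norm_reflection_eq_schur_param:
  "norm (matrix_inv (ctransp (a (Suc n) (Suc n))) ** transpose (b (Suc n) 0)) = norm (schur_param a b n)"
proof -
  define C E G where "C = leading_ratio a n" and "E = dual_ratio b n" and "G = schur_param a b n"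
  interpret schur_step C E G
    unfolding C_def E_def G_def by (rule schur_step[OF a b])
  have inv: "invertible (a n n)"
    using a by (simp add: orthonormal_seq_def)
  have a': "a (Suc n) (Suc n) = C ** a n n"
    by (simp add: C_def leading_ratio_def matrix_mul_assoc[symmetric] invertible_matrix_inv inv)
  have "b (Suc n) 0 = leading_ratio b n ** (transpose G ** mat_cnj (a n n))"
    using circle_functional.szego_recurrence(1)[OF dual b, of a n 0] a
    by (simp add: schur_param_dual G_def rev_coeff_def)
  then have b': "transpose (b (Suc n) 0) = ctransp (a n n) ** G ** ctransp E"
    by (simp add: E_def dual_ratio_def matrix_transpose_mul matrix_mul_assoc)
  have "matrix_inv (ctransp (a (Suc n) (Suc n))) = matrix_inv (ctransp C) ** matrix_inv (ctransp (a n n))"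
    by (simp add: a' ctransp_mult matrix_inv_mult invertible_ctransp inv invertible_C)
  then have "matrix_inv (ctransp (a (Suc n) (Suc n))) ** transpose (b (Suc n) 0) =
      matrix_inv (ctransp C) ** (matrix_inv (ctransp (a n n)) ** ctransp (a n n)) ** G ** ctransp E"
    by (simp add: b' matrix_mul_assoc)
  also have "\<dots> = matrix_inv (ctransp C) ** G ** ctransp E"
    by (simp add: invertible_matrix_inv invertible_ctransp inv)
  finally show ?thesis
    unfolding G_def[symmetric]
    by (simp add: norm_reflection invertible_matrix_inv invertible_ctransp invertible_C)
qed

end

end

subsection \<open>Matrix measures\<close>

lemma sets_form_measure: "sets (form_measure \<rho> x) = sets circle"
  unfolding form_measure_def sets.sets_measure_of_eq ..

lemma space_form_measure: "space (form_measure \<rho> x) = sphere 0 1"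
  using sets_eq_imp_space_eq[OF sets_form_measure] by (simp add: space_restrict_space)

lemma herm_form_scale: "herm_form A (c *s x) = c * cnj c * herm_form A x"
  by (simp add: herm_form_def sum_distrib_left mult_ac)

lemma form_measure_scale:
  assumes "cmod c = 1"
  shows "form_measure \<rho> (c *s x) = form_measure \<rho> x"
proof -
  have "c * cnj c = 1"
    using assms by (simp add: complex_norm_square[symmetric])
  then show ?thesis
    by (simp add: form_measure_def herm_form_scale)
qed

lemma integrable_form_measure:
  fixes f :: "complex \<Rightarrow> complex"
  assumes "matrix_measure \<rho>" "cont f"
  shows "integrable (form_measure \<rho> x) f"
proof -
  interpret finite_measure "form_measure \<rho> x"
  proof
    show "emeasure (form_measure \<rho> x) (space (form_measure \<rho> x)) \<noteq> \<infinity>"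
      using assms(1) sets.top[of "form_measure \<rho> x"]
      by (simp add: emeasure_form_measure sets_form_measure)
  qed
  have "compact (f ` sphere 0 1)"
    using assms(2) by (intro compact_continuous_image) auto
  then obtain B where B: "\<forall>z\<in>sphere 0 1. norm (f z) \<le> B"
    using compact_imp_bounded[of "f ` sphere 0 1"] by (auto simp: bounded_iff)
  have "f \<in> borel_measurable (form_measure \<rho> x)"
    using borel_measurable_continuous_on_restrict[OF assms(2)]
    by (simp add: measurable_cong_sets[OF sets_form_measure refl])
  then show ?thesis
    using B by (intro integrable_const_bound[where B = B] AE_I2) (simp_all add: space_form_measure)
qed

lemma entry_integral_expand:
  "entry_integral \<rho> i j f = (1 / 4) * (
    (LINT z|form_measure \<rho> (axis i 1 + axis j 1). f z) +
    \<i> * (LINT z|form_measure \<rho> (axis i 1 + \<i> *s axis j 1). f z) -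
    (LINT z|form_measure \<rho> (axis i 1 - axis j 1). f z) -
    \<i> * (LINT z|form_measure \<rho> (axis i 1 - \<i> *s axis j 1). f z))"
  by (simp add: entry_integral_def eval_nat_numeral)

lemma circle_functional_entry_integral:
  assumes "matrix_measure \<rho>"
  shows "circle_functional (entry_integral \<rho>)"
proof
  note int = integrable_form_measure[OF assms]
  fix f g :: "complex \<Rightarrow> complex" and k l :: 'a and c :: complex
  show "entry_integral \<rho> k l (\<lambda>z. f z + g z) = entry_integral \<rho> k l f + entry_integral \<rho> k l g"
    if "cont f" "cont g"
    unfolding entry_integral_def using int that by (simp add: distrib_left sum.distrib)
  show "entry_integral \<rho> k l (\<lambda>z. c * f z) = c * entry_integral \<rho> k l f"
    by (simp add: entry_integral_def sum_distrib_left mult_ac)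
  show "entry_integral \<rho> k l f = entry_integral \<rho> k l g" if "\<And>z. cmod z = 1 \<Longrightarrow> f z = g z"
    unfolding entry_integral_def using that
    by (intro arg_cong2[where f = "(*)"] sum.cong refl Bochner_Integration.integral_cong) (simp_all add: space_form_measure)
  \<comment> \<open>Exchanging \<open>k\<close> and \<open>l\<close> changes the polarization
    vectors by unimodular factors, invisible to \<open>form_measure\<close>. The terms with \<i> and
    - \<i> trade places, as conjugation requires.\<close>
  have "axis k 1 + axis l 1 = axis l 1 + (axis k 1 :: complex^'a)"
    by (simp add: add.commute)
  moreover have "form_measure \<rho> (axis l 1 + \<i> *s axis k 1) = form_measure \<rho> (axis k 1 - \<i> *s axis l 1)"
    using form_measure_scale[of "\<i>" \<rho> "axis k 1 - \<i> *s axis l 1"]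
    by (simp add: vector_sub_rdistrib vector_ssub_ldistrib vector_smult_assoc add.commute)
  moreover have "form_measure \<rho> (axis l 1 - \<i> *s axis k 1) = form_measure \<rho> (axis k 1 + \<i> *s axis l 1)"
    using form_measure_scale[of "- \<i>" \<rho> "axis k 1 + \<i> *s axis l 1"]
    by (simp add: vector_add_ldistrib vector_smult_assoc)
  moreover have "form_measure \<rho> (axis l 1 - axis k 1) = form_measure \<rho> (axis k 1 - axis l 1)"
    using form_measure_scale[of "-1" \<rho> "axis k 1 - axis l 1"] by simp
  ultimately show "entry_integral \<rho> k l (\<lambda>z. cnj (f z)) = cnj (entry_integral \<rho> l k f)"
    unfolding entry_integral_expand by (simp add: algebra_simps)
qed

section \<open>Translation to matrix polynomials and the equivalence\<close>

lemma mpoly_eval_eq_ev: "degree P = n \<Longrightarrow> mpoly_eval P = ev n (coeff P)"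
  by (simp add: fun_eq_iff mpoly_eval_def ev_def mat_mult_eq_scale_mat)

lemma orthonormal_seq_left:
  assumes "left_orthonormal \<rho> \<phi>"
  shows "orthonormal_seq (entry_integral \<rho>) (\<lambda>n. coeff (\<phi> n))"
proof -
  have deg: "degree (\<phi> n) = n" for n
    using assms by (simp add: left_orthonormal_def)
  have "ip (entry_integral \<rho>) F G = matrix_integral \<rho> F (\<lambda>z. ctransp (G z))" for F G
    by (simp add: ip_def matrix_integral_def)
  then show ?thesis
    using assms unfolding left_orthonormal_def orthonormal_seq_def mpoly_eval_eq_ev[OF deg]
    by (metis deg)
qed

lemma ev_transpose: "ev n (\<lambda>k. transpose (c k)) z = transpose (ev n c z)"
  by (simp add: ev_def transpose_sum)

text \<open>Transposition reverses the matrix products, moving the adjoint factor from the left of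
  the measure to its right.\<close>

lemma orthonormal_seq_right:
  assumes "right_orthonormal \<rho> \<phi>"
  shows "orthonormal_seq (\<lambda>k l. entry_integral \<rho> l k) (\<lambda>n k. transpose (coeff (\<phi> n) k))"
proof -
  have deg: "degree (\<phi> n) = n" for n
    using assms by (simp add: right_orthonormal_def)
  have eq: "ip (\<lambda>k l. entry_integral \<rho> l k) (\<lambda>z. transpose (F z)) (\<lambda>z. transpose (G z)) =
      transpose (matrix_integral \<rho> (\<lambda>z. ctransp (G z)) F)" for F G
    unfolding vec_eq_iff
    by (simp add: ip_def matrix_integral_def mult.commute) (subst sum.swap, simp)
  have "ip (\<lambda>k l. entry_integral \<rho> l k) (ev n (\<lambda>k. transpose (coeff (\<phi> n) k))) (ev m (\<lambda>k. transpose (coeff (\<phi> m) k))) =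
      (if m = n then mat 1 else 0)" for n m
    using eq[of "ev n (coeff (\<phi> n))" "ev m (coeff (\<phi> m))"] assms
    by (simp add: ev_transpose[abs_def, symmetric] right_orthonormal_def mpoly_eval_eq_ev[OF deg])
      (auto simp: vec_eq_iff mat_def)
  then show ?thesis
    using assms by (auto simp: right_orthonormal_def orthonormal_seq_def deg invertible_transpose)
qed

theorem lemma1:
  fixes \<rho> :: "complex set \<Rightarrow> complex^'p^'p"
    and \<phi>L \<phi>R :: "nat \<Rightarrow> (complex^'p^'p) poly"
  assumes "matrix_measure \<rho>" and "nondegenerate \<rho>"
    and "left_orthonormal \<rho> \<phi>L" and "right_orthonormal \<rho> \<phi>R"
  shows "(\<lambda>n. reflection_coeff \<phi>L \<phi>R n) \<longlonglongrightarrow> 0 \<longleftrightarrow>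
    (\<lambda>n. INF l\<in>{1..}. 1 / (2 * pi) * integral {0..2 * pi} (\<lambda>\<theta>.
        let A = mpoly_eval (\<phi>L n) (cis \<theta>); B = mpoly_eval (\<phi>L (n + l)) (cis \<theta>)
        in spectral_norm (A ** matrix_inv B ** matrix_inv (ctransp B) ** ctransp A - mat 1)))
      \<longlonglongrightarrow> 0"
proof -
  define e where "e = entry_integral \<rho>"
  define a where "a n = coeff (\<phi>L n)" for n
  define b where "b n k = transpose (coeff (\<phi>R n) k)" for n k
  interpret circle_functional e
    unfolding e_def using assms(1) by (rule circle_functional_entry_integral)
  have a: "orthonormal_seq e a"
    unfolding e_def a_def[abs_def] using assms(3) by (rule orthonormal_seq_left)
  have b: "orthonormal_seq (\<lambda>k l. e l k) b"
    unfolding e_def b_def[abs_def] using assms(4) by (rule orthonormal_seq_right)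
  have deg: "degree (\<phi>L n) = n" for n
    using assms(3) by (simp add: left_orthonormal_def)
  define H where "H = reflection_coeff \<phi>L \<phi>R"
  define G where "G = schur_param a b"
  define D where "D n l = 1 / (2 * pi) * integral {0..2 * pi} (\<lambda>t. spectral_norm (defect a n (n + l) (cis t)))" for n l
  \<comment> \<open>Invertibility on the circle identifies the inverse of the adjoint with the
    adjoint of the inverse.\<close>
  have defect: "(let A = mpoly_eval (\<phi>L n) (cis t); B = mpoly_eval (\<phi>L (n + l)) (cis t)
      in spectral_norm (A ** matrix_inv B ** matrix_inv (ctransp B) ** ctransp A - mat 1)) =
      spectral_norm (defect a n (n + l) (cis t))" for n l t
    using invertible_circle[OF a b, of "cis t" "n + l"]
    by (simp add: defect_def szego_weight_def mpoly_eval_eq_ev[OF deg] a_def matrix_inv_ctransp matrix_mul_assoc Let_def)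
  have integrable: "(\<lambda>t. spectral_norm (defect a n m (cis t))) integrable_on {0..2 * pi}" for n m
    by (rule integrable_cis[OF continuous_on_spectral_norm[OF cont_defect[OF a b]]])
  have D_nonneg: "0 \<le> D n l" for n l
    unfolding D_def by (intro mult_nonneg_nonneg integral_nonneg integrable) (simp_all add: spectral_norm_nonneg)
  have HG: "norm (H (Suc n)) = norm (G n)" for n
    using norm_reflection_eq_schur_param[OF a b, of n]
    by (simp add: H_def G_def reflection_coeff_def a_def b_def)
  \<comment> \<open>\<open>G n\<close> governs \<open>H (Suc n)\<close>, so the index is shifted
    first.\<close>
  have "H \<longlonglongrightarrow> 0 \<longleftrightarrow> (\<lambda>n. H (Suc n)) \<longlonglongrightarrow> 0"
    by (rule filterlim_sequentially_Suc[symmetric])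
  also have "\<dots> \<longleftrightarrow> (\<lambda>n. norm (G n)) \<longlonglongrightarrow> 0"
    by (subst tendsto_norm_zero_iff[symmetric]) (simp add: HG)
  also have "\<dots> \<longleftrightarrow> (\<lambda>n. INF l\<in>{1..}. D n l) \<longlonglongrightarrow> 0"
  proof
    assume G: "(\<lambda>n. norm (G n)) \<longlonglongrightarrow> 0"
    let ?u = "\<lambda>g::real. (2 * g + 2 * g\<^sup>2) / (1 - g)\<^sup>2"
    have u: "(\<lambda>n. ?u (norm (G n))) \<longlonglongrightarrow> ?u 0"
      by (intro tendsto_intros G) simp
    \<comment> \<open>The term \<open>l = 1\<close> alone bounds the infimum; the pointwise estimate
      is uniform in the angle and is averaged.\<close>
    have D1: "D n 1 \<le> ?u (norm (G n))" if "norm (G n) < 1" for n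
    proof -
      have "integral {0..2 * pi} (\<lambda>t. spectral_norm (defect a n (n + 1) (cis t))) \<le>
          integral {0..2 * pi} (\<lambda>t. ?u (norm (G n)))"
        using that spectral_norm_defect_Suc_le[OF a b, of "cis _" n]
        by (intro integral_le integrable integrable_continuous_real[OF continuous_on_const]) (simp_all add: G_def)
      then show ?thesis by (simp add: D_def field_simps)
    qed
    have "\<forall>\<^sub>F n in sequentially. norm (G n) < 1"
      using G by (rule order_tendstoD) simp
    then have upper: "\<forall>\<^sub>F n in sequentially. (INF l\<in>{1..}. D n l) \<le> ?u (norm (G n))"
    proof eventually_elim
      case (elim n)
      have "(INF l\<in>{1..}. D n l) \<le> D n 1"
        by (intro cINF_lower bdd_belowI2[where m = 0] D_nonneg) simp
      then show ?case using D1[OF elim] by simp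
    qed
    have lower: "\<forall>\<^sub>F n in sequentially. 0 \<le> (INF l\<in>{1..}. D n l)"
      by (intro always_eventually allI cINF_greatest D_nonneg) simp
    show "(\<lambda>n. INF l\<in>{1..}. D n l) \<longlonglongrightarrow> 0"
      using real_tendsto_sandwich[OF lower upper tendsto_const] u by simp
  next
    assume L: "(\<lambda>n. INF l\<in>{1..}. D n l) \<longlonglongrightarrow> 0"
    have "(\<lambda>n. G n $ i $ j) \<longlonglongrightarrow> 0" for i j
    proof (rule Lim_null_comparison[OF _ L])
      \<comment> \<open>The bound holds for every \<open>l \<ge> 1\<close>, hence for the
        infimum.\<close>
      have "cmod (G n $ i $ j) \<le> (INF l\<in>{1..}. D n l)" for n
        using cmod_schur_param_le[OF a b, of n "n + _" i j]
        by (intro cINF_greatest) (simp_all add: D_def G_def)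
      then show "\<forall>\<^sub>F n in sequentially. norm (G n $ i $ j) \<le> (INF l\<in>{1..}. D n l)"
        by simp
    qed
    then have "G \<longlonglongrightarrow> 0"
      by (intro vec_tendstoI) simp
    then show "(\<lambda>n. norm (G n)) \<longlonglongrightarrow> 0"
      by (rule tendsto_norm_zero)
  qed
  finally show ?thesis
    by (simp only: H_def D_def defect)
qed

end
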